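(* Let $P_1$ be the law on $\mathbb{Z}$ with $P_1(1)=P_1(-1)=1/2$ and let $P_2$ be the discrete Cauchy law. Then for every process $(S_0,(S_n,i(n))_{n\ge1})$ with $S_n\in\mathbb{Z}$ and $i(n)\in\{1,2\}$ that satisfies (CL) with the laws $P_1,P_2$, the process $\{S_n\}_{n\ge0}$ is recurrent. In particular, Benjamini's process, for which $i(n+1)=2$ if $S_n\notin\{S_0,\dots,S_{n-1}\}$ and $i(n+1)=1$ otherwise, is recurrent.
   Context: The discrete Cauchy law is the law on $\mathbb{Z}$ of the first return position to the horizontal axis of simple random walk on $\mathbb{Z}^2$: if $(U,V)$ is simple random walk on $\mathbb{Z}^2$ (steps $(\pm1,0),(0,\pm1)$ with probability $1/4$ each) started at $(0,0)$ and $T=\inf\{n>0: V(n)=0\}$, it is the law of $U_T$. (CL): the process $(S_0,(S_n,i(n))_{n\ge1})$ satisfies (CL) with the laws $P_1,P_2$ if for all $n\ge0$ the conditional law of $S_{n+1}-S_n$ given $\mathcal{H}_n\vee\sigma(i(n+1))$ is $P_{i(n+1)}$, where $\mathcal{H}_n=\sigma(S_0)\vee\sigma((S_\ell,i(\ell))_{1\le\ell\le n})$. A process on $\mathbb{Z}$ is recurrent if for any $u\in\mathbb{Z}$ it visits $u$ infinitely often, almost surely. *)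

theory Defs
  imports "HOL-Probability.Probability"
begin

definition srw_increment :: "(int \<times> int) pmf" where
  "srw_increment = pmf_of_set {(1, 0), (-1, 0), (0, 1), (0, -1)}"

definition srw_space :: "(nat \<Rightarrow> int \<times> int) measure" where
  "srw_space = (\<Pi>\<^sub>M k\<in>(UNIV::nat set). measure_pmf srw_increment)"

definition srw_U :: "nat \<Rightarrow> (nat \<Rightarrow> int \<times> int) \<Rightarrow> int" where
  "srw_U n \<omega> = (\<Sum>k<n. fst (\<omega> k))"

definition srw_V :: "nat \<Rightarrow> (nat \<Rightarrow> int \<times> int) \<Rightarrow> int" where
  "srw_V n \<omega> = (\<Sum>k<n. snd (\<omega> k))"

(* On the null event that the walk never returns to the axis, the value is arbitrary. *)
definition axis_return_time :: "(nat \<Rightarrow> int \<times> int) \<Rightarrow> nat" where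
  "axis_return_time \<omega> = (LEAST n. 0 < n \<and> srw_V n \<omega> = 0)"

definition discrete_cauchy :: "int measure" where
  "discrete_cauchy =
     distr srw_space (count_space UNIV) (\<lambda>\<omega>. srw_U (axis_return_time \<omega>) \<omega>)"

(* distr is only meaningful for a measurable map. *)
lemma measurable_axis_return_position:
  "(\<lambda>\<omega>. srw_U (axis_return_time \<omega>) \<omega>) \<in> srw_space \<rightarrow>\<^sub>M count_space UNIV"
proof -
  have comp: "(\<lambda>\<omega>. f (\<omega> k)) \<in> srw_space \<rightarrow>\<^sub>M count_space UNIV"
    for f :: "int \<times> int \<Rightarrow> int" and k
    unfolding srw_space_def
    by (rule measurable_compose[OF measurable_component_singleton]) auto
  have U [measurable]: "srw_U n \<in> srw_space \<rightarrow>\<^sub>M count_space UNIV" for n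
    unfolding srw_U_def
  proof (induction n)
    case (Suc n)
    then show ?case
      using comp[of fst n] by simp measurable
  qed simp
  have V [measurable]: "srw_V n \<in> srw_space \<rightarrow>\<^sub>M count_space UNIV" for n
    unfolding srw_V_def
  proof (induction n)
    case (Suc n)
    then show ?case
      using comp[of snd n] by simp measurable
  qed simp
  have "axis_return_time \<in> srw_space \<rightarrow>\<^sub>M count_space UNIV"
    unfolding axis_return_time_def by measurable
  then show ?thesis
    by (rule measurable_compose_countable[OF U])
qed

lemma prob_space_discrete_cauchy: "prob_space discrete_cauchy"
proof -
  interpret prob_space srw_space
    unfolding srw_space_def by (intro prob_space_PiM prob_space_measure_pmf)
  show ?thesis
    unfolding discrete_cauchy_def by (rule prob_space_distr[OF measurable_axis_return_position])
qed

definition P1 :: "int measure" where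
  "P1 = measure_pmf (pmf_of_set {1, -1})"

definition P2 :: "int measure" where
  "P2 = discrete_cauchy"

(* The value i 0 is not part of the process and is left unconstrained. *)
definition indexed_process ::
  "'a measure \<Rightarrow> (nat \<Rightarrow> 'a \<Rightarrow> int) \<Rightarrow> (nat \<Rightarrow> 'a \<Rightarrow> nat) \<Rightarrow> bool" where
  "indexed_process M S i \<longleftrightarrow>
     prob_space M \<and>
     (\<forall>n. S n \<in> M \<rightarrow>\<^sub>M count_space UNIV) \<and>
     (\<forall>n\<ge>1. i n \<in> M \<rightarrow>\<^sub>M count_space UNIV) \<and>
     (\<forall>n\<ge>1. \<forall>\<omega>\<in>space M. i n \<omega> \<in> {1, 2})"

definition history ::
  "'a measure \<Rightarrow> (nat \<Rightarrow> 'a \<Rightarrow> int) \<Rightarrow> (nat \<Rightarrow> 'a \<Rightarrow> nat) \<Rightarrow> nat \<Rightarrow> 'a measure" where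
  "history M S i n = sigma (space M)
     (sets (vimage_algebra (space M) (S 0) (count_space UNIV)) \<union>
      (\<Union>l\<in>{1..n}. sets (vimage_algebra (space M) (\<lambda>\<omega>. (S l \<omega>, i l \<omega>)) (count_space UNIV))))"

definition history_with_next_index ::
  "'a measure \<Rightarrow> (nat \<Rightarrow> 'a \<Rightarrow> int) \<Rightarrow> (nat \<Rightarrow> 'a \<Rightarrow> nat) \<Rightarrow> nat \<Rightarrow> 'a measure" where
  "history_with_next_index M S i n = sigma (space M)
     (sets (history M S i n) \<union>
      sets (vimage_algebra (space M) (i (Suc n)) (count_space UNIV)))"

definition satisfies_CL ::
  "int measure \<Rightarrow> int measure \<Rightarrow> 'a measure \<Rightarrow> (nat \<Rightarrow> 'a \<Rightarrow> int) \<Rightarrow> (nat \<Rightarrow> 'a \<Rightarrow> nat) \<Rightarrow> bool" where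
  "satisfies_CL Q1 Q2 M S i \<longleftrightarrow>
     (\<forall>n. \<forall>A :: int set. AE \<omega> in M.
        real_cond_exp M (history_with_next_index M S i n)
          (indicator {\<omega> \<in> space M. S (Suc n) \<omega> - S n \<omega> \<in> A}) \<omega>
        = measure (if i (Suc n) \<omega> = 1 then Q1 else Q2) A)"

definition recurrent :: "'a measure \<Rightarrow> (nat \<Rightarrow> 'a \<Rightarrow> int) \<Rightarrow> bool" where
  "recurrent M S \<longleftrightarrow> (\<forall>u. AE \<omega> in M. infinite {n. S n \<omega> = u})"

definition benjamini_process ::
  "'a measure \<Rightarrow> (nat \<Rightarrow> 'a \<Rightarrow> int) \<Rightarrow> (nat \<Rightarrow> 'a \<Rightarrow> nat) \<Rightarrow> bool" where
  "benjamini_process M S i \<longleftrightarrow>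
     indexed_process M S i \<and> satisfies_CL P1 P2 M S i \<and>
     (\<forall>n. \<forall>\<omega>\<in>space M.
        i (Suc n) \<omega> = (if S n \<omega> \<notin> (\<lambda>k. S k \<omega>) ` {..<n} then 2 else 1))"

end

theory Submission
  imports Defs
begin

text \<open>
  Both step laws admit one and the same Lyapunov function. Let \<open>a\<close> be the potential kernel of simple
  random walk on \<open>\<int>\<^sup>2\<close>, up to a constant factor: it is nonnegative, vanishes at the origin and is
  discrete harmonic everywhere else. Put \<open>f x = a (x, 0)\<close>.

  For the discrete Cauchy law, run the planar walk from \<open>(x, 0)\<close>, with \<open>x \<noteq> 0\<close>, until it returns to
  the horizontal axis. It does not meet the origin before that time, so \<open>a\<close> is harmonic along the
  path, and optional stopping for the nonnegative function \<open>a\<close> gives \<open>E f (x + k) \<le> f x\<close> for a Cauchy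
  step \<open>k\<close> (\<open>P2_superharmonic\<close>). For the nearest neighbour law, the same inequality says that \<open>f\<close> is
  concave on either side of the origin (\<open>P1_superharmonic\<close>). Hence \<open>f (S n - u)\<close> is a supermartingale
  as long as the process avoids \<open>u\<close>, whatever rule selects the laws.

  Since \<open>f\<close> grows at least like a harmonic sum, its sublevel sets are finite. Adding the bounded
  function \<open>1 - (1 / 5) ^ nat \<bar>x\<bar>\<close> makes the drift strictly negative off the origin, because
  both laws charge \<open>1\<close> and \<open>-1\<close> with mass at least one quarter (\<open>strict_drift\<close>). A Lyapunov function
  with finite sublevel sets and strictly negative drift off \<open>u\<close> forces infinitely many
  visits to \<open>u\<close> (\<open>Lyapunov_recurrence\<close>).

  Everything about \<open>a\<close> is read off from the integral
  \<open>a (x, y) = \<integral> (1 - cos (x \<theta>) exp (- s \<bar>y\<bar>)) / sinh s d\<theta>\<close> over \<open>0 < \<theta> < \<pi>\<close>, where \<open>s \<ge> 0\<close> solves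
  \<open>cos \<theta> + cosh s = 2\<close>. That equation makes \<open>cos (x \<theta>) exp (- s y)\<close> harmonic off the
  axis; dividing by \<open>sinh s\<close> normalizes its defect on the axis to \<open>2 cos (x \<theta>)\<close>, whose integral
  vanishes unless \<open>x = 0\<close>.
\<close>

section \<open>Processes with the conditional law property\<close>

lemma history_facts:
  assumes "indexed_process M S i"
  shows "space (history M S i n) = space M"
    and "sets (history M S i n) \<subseteq> sets M"
    and "k \<le> n \<Longrightarrow> S k -` A \<inter> space M \<in> sets (history M S i n)"
proof -
  have S: "S n \<in> M \<rightarrow>\<^sub>M count_space UNIV" for n
    using assms by (simp add: indexed_process_def)
  have i: "i n \<in> M \<rightarrow>\<^sub>M count_space UNIV" if "n \<ge> 1" for n
    using assms that by (simp add: indexed_process_def)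
  have pair: "(\<lambda>\<omega>. (S l \<omega>, i l \<omega>)) \<in> M \<rightarrow>\<^sub>M count_space UNIV" if "l \<ge> 1" for l
  proof -
    have "(\<lambda>\<omega>. (S l \<omega>, i l \<omega>)) \<in> M \<rightarrow>\<^sub>M count_space UNIV \<Otimes>\<^sub>M count_space UNIV"
      using S[of l] i[OF that] by (rule measurable_Pair)
    then show ?thesis by (simp add: pair_measure_countable)
  qed
  define X where "X = sets (vimage_algebra (space M) (S 0) (count_space UNIV)) \<union>
      (\<Union>l\<in>{1..n}. sets (vimage_algebra (space M) (\<lambda>\<omega>. (S l \<omega>, i l \<omega>)) (count_space UNIV)))"
  have X: "X \<subseteq> sets M"
    using S[of 0] pair unfolding X_def
    by (auto simp: sets_vimage_algebra2 measurable_sets)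
  then have Pow: "X \<subseteq> Pow (space M)" using sets.space_closed by blast
  show sp: "space (history M S i n) = space M"
    unfolding history_def by (rule space_measure_of_conv)
  have sets: "sets (history M S i n) = sigma_sets (space M) X"
    using Pow by (simp add: history_def X_def)
  show "sets (history M S i n) \<subseteq> sets M"
    unfolding sets using X by (rule sets.sigma_sets_subset)
  assume "k \<le> n"
  have "S k -` A \<inter> space M \<in> X"
  proof (cases "k = 0")
    case True
    then show ?thesis by (auto simp: X_def sets_vimage_algebra2)
  next
    case False
    have "S k -` A \<inter> space M = (\<lambda>\<omega>. (S k \<omega>, i k \<omega>)) -` (A \<times> UNIV) \<inter> space M" by auto
    then have "S k -` A \<inter> space M \<in> sets (vimage_algebra (space M) (\<lambda>\<omega>. (S k \<omega>, i k \<omega>)) (count_space UNIV))"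
      by (auto simp: sets_vimage_algebra2)
    then show ?thesis using False \<open>k \<le> n\<close> by (force simp: X_def)
  qed
  then show "S k -` A \<inter> space M \<in> sets (history M S i n)"
    unfolding sets by (rule sigma_sets.Basic)
qed

lemma history_with_next_index_facts:
  assumes "indexed_process M S i"
  shows "subalgebra M (history_with_next_index M S i n)"
    and "A \<in> sets (history M S i n) \<Longrightarrow> A \<in> sets (history_with_next_index M S i n)"
    and "i (Suc n) -` J \<inter> space M \<in> sets (history_with_next_index M S i n)"
proof -
  have i: "i (Suc n) \<in> M \<rightarrow>\<^sub>M count_space UNIV"
    using assms by (simp add: indexed_process_def)
  define X where "X = sets (history M S i n) \<union>
      sets (vimage_algebra (space M) (i (Suc n)) (count_space UNIV))"
  have X: "X \<subseteq> sets M"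
    using history_facts(2)[OF assms] i unfolding X_def
    by (auto simp: sets_vimage_algebra2 measurable_sets)
  then have Pow: "X \<subseteq> Pow (space M)" using sets.space_closed by blast
  have sets: "sets (history_with_next_index M S i n) = sigma_sets (space M) X"
    using Pow by (simp add: history_with_next_index_def X_def)
  show "subalgebra M (history_with_next_index M S i n)"
  proof -
    have "space (history_with_next_index M S i n) = space M"
      unfolding history_with_next_index_def by (rule space_measure_of_conv)
    then show ?thesis
      unfolding subalgebra_def sets using X sets.sigma_sets_subset by blast
  qed
  show "A \<in> sets (history M S i n) \<Longrightarrow> A \<in> sets (history_with_next_index M S i n)"
    unfolding sets by (rule sigma_sets.Basic) (simp add: X_def)
  show "i (Suc n) -` J \<inter> space M \<in> sets (history_with_next_index M S i n)"
    unfolding sets by (rule sigma_sets.Basic) (auto simp: X_def sets_vimage_algebra2)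
qed

text \<open>
  Integrating the conditional probabilities over an event of the conditioning \<open>\<sigma>\<close>-algebra turns the
  almost sure identities into a product formula for measures.
\<close>

lemma CL_emeasure:
  assumes ip: "indexed_process M S i" and CL: "satisfies_CL Q1 Q2 M S i"
    and Q: "prob_space Q1" "prob_space Q2"
    and D: "D \<in> sets (history M S i n)"
  shows "emeasure M {\<omega>\<in>D. i (Suc n) \<omega> = j \<and> S (Suc n) \<omega> - S n \<omega> \<in> B}
     = emeasure M {\<omega>\<in>D. i (Suc n) \<omega> = j} * emeasure (if j = 1 then Q1 else Q2) B"
proof -
  interpret prob_space M using ip by (simp add: indexed_process_def)
  define F where "F = history_with_next_index M S i n"
  have sub: "subalgebra M F" unfolding F_def by (rule history_with_next_index_facts[OF ip])
  interpret F: finite_measure_subalgebra M F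
    by (intro finite_measure_subalgebra.intro finite_measure_subalgebra_axioms.intro sub) unfold_locales
  have [measurable]: "S n \<in> M \<rightarrow>\<^sub>M count_space UNIV" for n
    using ip by (simp add: indexed_process_def)
  define C where "C = D \<inter> (i (Suc n) -` {j} \<inter> space M)"
  have CF: "C \<in> sets F"
    unfolding C_def F_def using D by (intro sets.Int history_with_next_index_facts[OF ip])
  then have [measurable]: "C \<in> sets M" using sub by (auto simp: subalgebra_def)
  have Dsp: "D \<subseteq> space M" using D history_facts(1)[OF ip] sets.sets_into_space by blast
  have C: "C = {\<omega>\<in>D. i (Suc n) \<omega> = j}" using Dsp by (auto simp: C_def)
  define E where "E = {\<omega> \<in> space M. S (Suc n) \<omega> - S n \<omega> \<in> B}"
  have [measurable]: "E \<in> sets M" unfolding E_def by measurable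
  define q where "q = measure (if j = 1 then Q1 else Q2) B"
  have "measure M (C \<inter> E) = (\<integral>\<omega>\<in>C. indicator E \<omega> \<partial>M)"
    by (simp add: set_lebesgue_integral_def flip: indicator_inter_arith)
  also have "\<dots> = (\<integral>\<omega>\<in>C. real_cond_exp M F (indicator E) \<omega> \<partial>M)"
    by (rule F.real_cond_exp_intA) (auto simp: CF emeasure_eq_measure)
  also have "\<dots> = (\<integral>\<omega>\<in>C. q \<partial>M)"
  proof -
    have "AE \<omega> in M. real_cond_exp M F (indicator E) \<omega> = measure (if i (Suc n) \<omega> = 1 then Q1 else Q2) B"
      using CL unfolding satisfies_CL_def F_def E_def by blast
    then have "AE \<omega> in M. \<omega> \<in> C \<longrightarrow> real_cond_exp M F (indicator E) \<omega> = q"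
      by eventually_elim (auto simp: C q_def)
    then show ?thesis
      by (intro set_lebesgue_integral_cong_AE) auto
  qed
  also have "\<dots> = measure M C * q"
    by (simp add: set_lebesgue_integral_def)
  finally have "measure M (C \<inter> E) = measure M C * q" .
  moreover have "emeasure (if j = 1 then Q1 else Q2) B = ennreal q"
    unfolding q_def using Q by (auto simp: prob_space_def finite_measure.emeasure_eq_measure)
  moreover have "C \<inter> E = {\<omega>\<in>D. i (Suc n) \<omega> = j \<and> S (Suc n) \<omega> - S n \<omega> \<in> B}"
    using Dsp by (auto simp: C E_def)
  ultimately show ?thesis
    unfolding C[symmetric] by (simp add: emeasure_eq_measure ennreal_mult q_def)
qed

text \<open>
  The Markov-type step that drives the proof: on an event of the past, \<open>S (Suc n)\<close> may be
  integrated out with the law selected by \<open>i (Suc n)\<close>. The pair \<open>(S n, i (Suc n))\<close> takes countably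
  many values, and on each of its level sets the increment has a fixed law, by \<open>CL_emeasure\<close>.
\<close>

lemma CL_nn_integral_step:
  assumes ip: "indexed_process M S i" and CL: "satisfies_CL Q1 Q2 M S i"
    and Q: "prob_space Q1" "prob_space Q2" "sets Q1 = UNIV" "sets Q2 = UNIV"
    and D: "D \<in> sets (history M S i n)"
  shows "(\<integral>\<^sup>+\<omega>. h (S (Suc n) \<omega>) * indicator D \<omega> \<partial>M)
     = (\<integral>\<^sup>+\<omega>. (\<integral>\<^sup>+k. h (S n \<omega> + k) \<partial>(if i (Suc n) \<omega> = 1 then Q1 else Q2)) * indicator D \<omega> \<partial>M)"
    and "(\<lambda>\<omega>. \<integral>\<^sup>+k. h (S n \<omega> + k) \<partial>(if i (Suc n) \<omega> = 1 then Q1 else Q2)) \<in> borel_measurable M"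
proof -
  have [measurable]: "S n \<in> M \<rightarrow>\<^sub>M count_space UNIV" for n
    using ip by (simp add: indexed_process_def)
  have [measurable]: "i (Suc n) \<in> M \<rightarrow>\<^sub>M count_space UNIV"
    using ip by (simp add: indexed_process_def)
  have DM[measurable]: "D \<in> sets M" using D history_facts(2)[OF ip] by blast
  have Dsp: "D \<subseteq> space M" using DM by (rule sets.sets_into_space)
  define T where "T = (\<lambda>\<omega>. (S n \<omega>, i (Suc n) \<omega>))"
  have T[measurable]: "T \<in> M \<rightarrow>\<^sub>M count_space UNIV"
  proof -
    have "T \<in> M \<rightarrow>\<^sub>M count_space UNIV \<Otimes>\<^sub>M count_space UNIV"
      unfolding T_def by measurable
    then show ?thesis by (simp add: pair_measure_countable)
  qed
  define Q where "Q = (\<lambda>j::nat. if j = 1 then Q1 else Q2)"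
  define K where "K = (\<lambda>(x, j). \<integral>\<^sup>+k. h (x + k) \<partial>Q j)"
  have split: "(\<integral>\<^sup>+\<omega>. f \<omega> \<partial>M) = (\<integral>\<^sup>+xj. (\<integral>\<^sup>+\<omega>. f \<omega> * indicator {xj} (T \<omega>) \<partial>M) \<partial>count_space UNIV)"
    if [measurable]: "f \<in> borel_measurable M" for f :: "_ \<Rightarrow> ennreal"
  proof -
    have "(\<integral>\<^sup>+\<omega>. f \<omega> \<partial>M) = (\<integral>\<^sup>+\<omega>. (\<integral>\<^sup>+xj. f \<omega> * indicator {T \<omega>} xj \<partial>count_space UNIV) \<partial>M)"
      by (simp add: nn_integral_cmult)
    also have "\<dots> = (\<integral>\<^sup>+\<omega>. (\<integral>\<^sup>+xj. f \<omega> * indicator {xj} (T \<omega>) \<partial>count_space UNIV) \<partial>M)"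
      by (intro nn_integral_cong) (auto split: split_indicator)
    also have "\<dots> = (\<integral>\<^sup>+xj. (\<integral>\<^sup>+\<omega>. f \<omega> * indicator {xj} (T \<omega>) \<partial>M) \<partial>count_space UNIV)"
    proof (rule nn_integral_count_space_nn_integral)
      fix xj
      have [measurable]: "(\<lambda>\<omega>. indicator {xj} (T \<omega>) :: ennreal) \<in> borel_measurable M"
        by (rule measurable_compose[OF T]) simp
      show "(\<lambda>\<omega>. f \<omega> * indicator {xj} (T \<omega>)) \<in> borel_measurable M" by measurable
    qed simp
    finally show ?thesis .
  qed
  have "(\<integral>\<^sup>+\<omega>. h (S (Suc n) \<omega>) * indicator D \<omega> * indicator {xj} (T \<omega>) \<partial>M)
      = (\<integral>\<^sup>+\<omega>. K (T \<omega>) * indicator D \<omega> * indicator {xj} (T \<omega>) \<partial>M)" for xj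
  proof -
    obtain x j where xj: "xj = (x, j)" by (cases xj)
    define A where "A = {\<omega>\<in>D. T \<omega> = xj}"
    define A' where "A' = {\<omega>\<in>D. S n \<omega> = x}"
    have A'H: "A' \<in> sets (history M S i n)"
    proof -
      have "A' = D \<inter> (S n -` {x} \<inter> space M)" using Dsp by (auto simp: A'_def)
      then show ?thesis using D history_facts(3)[OF ip, of n n] by auto
    qed
    have A: "A = {\<omega>\<in>A'. i (Suc n) \<omega> = j}" by (auto simp: A_def A'_def T_def xj)
    have AD: "A = D \<inter> (T -` {xj} \<inter> space M)" using Dsp by (auto simp: A_def)
    have [measurable]: "A \<in> sets M" unfolding AD by measurable
    define \<Delta> where "\<Delta> = (\<lambda>\<omega>. S (Suc n) \<omega> - S n \<omega>)"
    have [measurable]: "\<Delta> \<in> M \<rightarrow>\<^sub>M count_space UNIV" unfolding \<Delta>_def by measurable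
    have setsQ: "sets (Q j) = UNIV" using Q(3,4) by (simp add: Q_def)
    have law: "distr (density M (indicator A)) (count_space UNIV) \<Delta> = scale_measure (emeasure M A) (Q j)"
    proof (rule measure_eqI)
      show "sets (distr (density M (indicator A)) (count_space UNIV) \<Delta>) = sets (scale_measure (emeasure M A) (Q j))"
        using setsQ by simp
      fix B assume "B \<in> sets (distr (density M (indicator A)) (count_space UNIV) \<Delta>)"
      have "emeasure (distr (density M (indicator A)) (count_space UNIV) \<Delta>) B
          = emeasure (density M (indicator A)) (\<Delta> -` B \<inter> space M)"
        by (subst emeasure_distr) auto
      also have "\<dots> = (\<integral>\<^sup>+\<omega>. indicator A \<omega> * indicator (\<Delta> -` B \<inter> space M) \<omega> \<partial>M)"
        by (rule emeasure_density) auto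
      also have "\<dots> = emeasure M (A \<inter> (\<Delta> -` B \<inter> space M))"
        by (simp flip: indicator_inter_arith)
      also have "A \<inter> (\<Delta> -` B \<inter> space M) = {\<omega>\<in>A'. i (Suc n) \<omega> = j \<and> S (Suc n) \<omega> - S n \<omega> \<in> B}"
        using Dsp by (auto simp: A A'_def \<Delta>_def)
      also have "emeasure M \<dots> = emeasure M A * emeasure (Q j) B"
        unfolding A Q_def by (rule CL_emeasure[OF ip CL Q(1,2) A'H])
      finally show "emeasure (distr (density M (indicator A)) (count_space UNIV) \<Delta>) B
         = emeasure (scale_measure (emeasure M A) (Q j)) B" by simp
    qed
    have "(\<integral>\<^sup>+\<omega>. h (S (Suc n) \<omega>) * indicator D \<omega> * indicator {xj} (T \<omega>) \<partial>M)
        = (\<integral>\<^sup>+\<omega>. indicator A \<omega> * h (x + \<Delta> \<omega>) \<partial>M)"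
      by (intro nn_integral_cong) (auto simp: A_def T_def xj \<Delta>_def split: split_indicator)
    also have "\<dots> = (\<integral>\<^sup>+k. h (x + k) \<partial>distr (density M (indicator A)) (count_space UNIV) \<Delta>)"
      by (simp add: nn_integral_distr nn_integral_density)
    also have "\<dots> = emeasure M A * K xj"
      unfolding law K_def xj
      using setsQ by (simp add: nn_integral_scale_measure measurable_def)
    also have "\<dots> = (\<integral>\<^sup>+\<omega>. K xj * indicator A \<omega> \<partial>M)"
      by (simp add: nn_integral_cmult mult.commute)
    also have "\<dots> = (\<integral>\<^sup>+\<omega>. K (T \<omega>) * indicator D \<omega> * indicator {xj} (T \<omega>) \<partial>M)"
      by (intro nn_integral_cong) (auto simp: A_def split: split_indicator)
    finally show ?thesis .
  qed
  then have "(\<integral>\<^sup>+\<omega>. h (S (Suc n) \<omega>) * indicator D \<omega> \<partial>M) = (\<integral>\<^sup>+\<omega>. K (T \<omega>) * indicator D \<omega> \<partial>M)"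
    by (subst (1 2) split) simp_all
  then show "(\<integral>\<^sup>+\<omega>. h (S (Suc n) \<omega>) * indicator D \<omega> \<partial>M)
     = (\<integral>\<^sup>+\<omega>. (\<integral>\<^sup>+k. h (S n \<omega> + k) \<partial>(if i (Suc n) \<omega> = 1 then Q1 else Q2)) * indicator D \<omega> \<partial>M)"
    by (simp add: K_def T_def Q_def)
  have "(\<lambda>\<omega>. K (T \<omega>)) \<in> borel_measurable M" by measurable
  then show "(\<lambda>\<omega>. \<integral>\<^sup>+k. h (S n \<omega> + k) \<partial>(if i (Suc n) \<omega> = 1 then Q1 else Q2)) \<in> borel_measurable M"
    by (simp add: K_def T_def Q_def)
qed

section \<open>A Lyapunov criterion for recurrence\<close>

lemma finite_uniform_gap:
  fixes a b :: "'p \<Rightarrow> ennreal"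
  assumes "finite A" "\<And>p. p \<in> A \<Longrightarrow> a p < b p"
  shows "\<exists>\<epsilon>>0. \<forall>p\<in>A. a p + \<epsilon> \<le> b p"
  using assms
proof (induction A)
  case (insert q A)
  then obtain e where e: "e > 0" "\<And>p. p \<in> A \<Longrightarrow> a p + e \<le> b p" by auto
  have q: "a q < b q" using insert.prems by simp
  have "0 < min e (b q - a q)" using e(1) diff_gr0_ennreal[OF q] by simp
  moreover have "a p + min e (b q - a q) \<le> b p" if "p \<in> insert q A" for p
  proof (cases "p = q")
    case True
    have "a q + min e (b q - a q) \<le> a q + (b q - a q)" by (intro add_left_mono) simp
    also have "\<dots> = b q" using q by (intro add_diff_inverse_ennreal) simp
    finally show ?thesis using True by simp
  next
    case False
    then have "a p + e \<le> b p" using e(2) that by simp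
    moreover have "a p + min e (b q - a q) \<le> a p + e" by (intro add_left_mono) simp
    ultimately show ?thesis by (rule order_trans[rotated])
  qed
  ultimately show ?case by blast
qed (auto intro: exI[of _ 1])

text \<open>
  Truncating \<open>g\<close> at level \<open>L\<close> keeps the drift condition and makes all expectations finite. On the
  event \<open>D m n\<close> of no visit to \<open>u\<close> during \<open>{m..m+n}\<close>, the truncated expectation loses at least
  \<open>\<epsilon> * P (low n)\<close> per step, where \<open>low n\<close> adds the condition \<open>g (S (m + n)) < L\<close>; here \<open>\<epsilon> > 0\<close> exists because
  the sublevel set is finite. So the probabilities of \<open>low n\<close> are summable, and in the limit a
  process that never visits \<open>u\<close> after time \<open>m\<close> sits above level \<open>L\<close>. Hence \<open>L * P (D' m)\<close> is at most
  \<open>E (min (g (S m)) L)\<close>. Dividing by \<open>L\<close> and letting \<open>L\<close> tend to infinity gives \<open>P (D' m) = 0\<close>.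
\<close>

lemma Lyapunov_recurrence:
  assumes ip: "indexed_process M S i" and CL: "satisfies_CL Q1 Q2 M S i"
    and Q: "prob_space Q1" "prob_space Q2" "sets Q1 = UNIV" "sets Q2 = UNIV"
    and fin: "\<And>L::real. finite {x. g x < L}" and g0: "\<And>x. 0 \<le> g x"
    and drift: "\<And>x R. x \<noteq> u \<Longrightarrow> R = Q1 \<or> R = Q2 \<Longrightarrow> (\<integral>\<^sup>+k. ennreal (g (x + k)) \<partial>R) < ennreal (g x)"
  shows "AE \<omega> in M. infinite {n. S n \<omega> = u}"
proof -
  interpret prob_space M using ip by (simp add: indexed_process_def)
  have [measurable]: "S n \<in> M \<rightarrow>\<^sub>M count_space UNIV" for n
    using ip by (simp add: indexed_process_def)
  define D where "D = (\<lambda>m n. {\<omega>\<in>space M. \<forall>k\<in>{m..m+n}. S k \<omega> \<noteq> u})"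
  define D' where "D' = (\<lambda>m. {\<omega>\<in>space M. \<forall>k\<ge>m. S k \<omega> \<noteq> u})"
  have [measurable]: "D m n \<in> sets M" "D' m \<in> sets M" for m n unfolding D_def D'_def by measurable
  have DH: "D m n \<in> sets (history M S i (m + n))" for m n
  proof -
    have "D m n = space M - (\<Union>k\<in>{m..m+n}. S k -` {u} \<inter> space M)" by (auto simp: D_def)
    moreover have "(\<Union>k\<in>{m..m+n}. S k -` {u} \<inter> space M) \<in> sets (history M S i (m + n))"
      using history_facts(3)[OF ip] by (intro sets.finite_UN) auto
    ultimately show ?thesis
      using sets.compl_sets[of _ "history M S i (m + n)"] history_facts(1)[OF ip] by metis
  qed
  have bound: "ennreal L * emeasure M (D' m) \<le> (\<integral>\<^sup>+\<omega>. min (ennreal (g (S m \<omega>))) (ennreal L) \<partial>M)"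
    if L: "0 \<le> L" for L m
  proof -
    define h where "h = (\<lambda>x. min (ennreal (g x)) (ennreal L))"
    obtain \<epsilon> :: ennreal where \<epsilon>: "0 < \<epsilon>" "\<And>x R. x \<noteq> u \<Longrightarrow> g x < L \<Longrightarrow> R = Q1 \<or> R = Q2 \<Longrightarrow>
        (\<integral>\<^sup>+k. ennreal (g (x + k)) \<partial>R) + \<epsilon> \<le> ennreal (g x)"
    proof -
      have "\<exists>\<epsilon>>0. \<forall>p\<in>({x. g x < L} - {u}) \<times> {Q1, Q2}.
          (\<integral>\<^sup>+k. ennreal (g (fst p + k)) \<partial>snd p) + \<epsilon> \<le> ennreal (g (fst p))"
      proof (rule finite_uniform_gap)
        show "finite (({x. g x < L} - {u}) \<times> {Q1, Q2})" using fin[of L] by simp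
        fix p assume "p \<in> ({x. g x < L} - {u}) \<times> {Q1, Q2}"
        then show "(\<integral>\<^sup>+k. ennreal (g (fst p + k)) \<partial>snd p) < ennreal (g (fst p))"
          by (intro drift) auto
      qed
      then obtain e :: ennreal where "0 < e" and e: "\<forall>p\<in>({x. g x < L} - {u}) \<times> {Q1, Q2}.
          (\<integral>\<^sup>+k. ennreal (g (fst p + k)) \<partial>snd p) + e \<le> ennreal (g (fst p))"
        by blast
      show thesis
      proof (rule that[OF \<open>0 < e\<close>])
        fix x R assume "x \<noteq> u" "g x < L" "R = Q1 \<or> R = Q2"
        then have "(x, R) \<in> ({x. g x < L} - {u}) \<times> {Q1, Q2}" by simp
        from bspec[OF e this] show "(\<integral>\<^sup>+k. ennreal (g (x + k)) \<partial>R) + e \<le> ennreal (g x)" by simp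
      qed
    qed
    define low where "low = (\<lambda>n. {\<omega>\<in>D m n. g (S (m+n) \<omega>) < L})"
    have [measurable]: "low n \<in> sets M" for n
    proof -
      have "low n = D m n \<inter> {\<omega>\<in>space M. g (S (m+n) \<omega>) < L}" by (auto simp: low_def D_def)
      then show ?thesis by simp
    qed
    define b where "b = (\<lambda>n. \<integral>\<^sup>+\<omega>. h (S (m+n) \<omega>) * indicator (D m n) \<omega> \<partial>M)"
    have step: "b (Suc n) + \<epsilon> * emeasure M (low n) \<le> b n" for n
    proof -
      have "b (Suc n) \<le> (\<integral>\<^sup>+\<omega>. h (S (Suc (m+n)) \<omega>) * indicator (D m n) \<omega> \<partial>M)"
        unfolding b_def by (intro nn_integral_mono) (auto simp: D_def split: split_indicator)
      also have "\<dots> = (\<integral>\<^sup>+\<omega>. (\<integral>\<^sup>+k. h (S (m+n) \<omega> + k) \<partial>(if i (Suc (m+n)) \<omega> = 1 then Q1 else Q2)) * indicator (D m n) \<omega> \<partial>M)"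
        by (rule CL_nn_integral_step[OF ip CL Q DH])
      finally have "b (Suc n) + \<epsilon> * emeasure M (low n) \<le> (\<integral>\<^sup>+\<omega>. (\<integral>\<^sup>+k. h (S (m+n) \<omega> + k) \<partial>(if i (Suc (m+n)) \<omega> = 1 then Q1 else Q2)) * indicator (D m n) \<omega> \<partial>M)
         + (\<integral>\<^sup>+\<omega>. \<epsilon> * indicator (low n) \<omega> \<partial>M)"
        by (simp add: nn_integral_cmult_indicator add_mono)
      also have "\<dots> \<le> (\<integral>\<^sup>+\<omega>. (\<integral>\<^sup>+k. h (S (m+n) \<omega> + k) \<partial>(if i (Suc (m+n)) \<omega> = 1 then Q1 else Q2)) * indicator (D m n) \<omega> + \<epsilon> * indicator (low n) \<omega> \<partial>M)"
        using CL_nn_integral_step(2)[OF ip CL Q DH, where h = h] by (subst nn_integral_add) auto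
      also have "\<dots> \<le> b n"
        unfolding b_def
      proof (intro nn_integral_mono)
        fix \<omega>
        define R where "R = (if i (Suc (m+n)) \<omega> = 1 then Q1 else Q2)"
        have R: "R = Q1 \<or> R = Q2" by (auto simp: R_def)
        interpret R: prob_space R using R Q by auto
        define x where "x = S (m+n) \<omega>"
        have "(\<integral>\<^sup>+k. h (x + k) \<partial>R) + (if g x < L then \<epsilon> else 0) \<le> h x" if "x \<noteq> u"
        proof (cases "g x < L")
          case True
          have "(\<integral>\<^sup>+k. h (x + k) \<partial>R) \<le> (\<integral>\<^sup>+k. ennreal (g (x + k)) \<partial>R)"
            unfolding h_def by (intro nn_integral_mono) auto
          then have "(\<integral>\<^sup>+k. h (x + k) \<partial>R) + \<epsilon> \<le> ennreal (g x)"
            using \<epsilon>(2)[OF that True R] by (meson add_right_mono order_trans)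
          then show ?thesis using True g0[of x] by (simp add: h_def min_def ennreal_leI)
        next
          case False
          have "(\<integral>\<^sup>+k. h (x + k) \<partial>R) \<le> (\<integral>\<^sup>+k. ennreal L \<partial>R)"
            unfolding h_def by (intro nn_integral_mono) auto
          moreover have "h x = ennreal L" using False by (simp add: h_def min_absorb2 ennreal_leI)
          ultimately show ?thesis using False by (simp add: R.emeasure_space_1)
        qed
        then show "(\<integral>\<^sup>+k. h (S (m+n) \<omega> + k) \<partial>(if i (Suc (m+n)) \<omega> = 1 then Q1 else Q2)) * indicator (D m n) \<omega> + \<epsilon> * indicator (low n) \<omega>
           \<le> h (S (m+n) \<omega>) * indicator (D m n) \<omega>"
          unfolding R_def[symmetric] x_def[symmetric]
          by (auto simp: low_def D_def x_def split: split_indicator)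
      qed
      finally show ?thesis .
    qed
    have sum: "b N + \<epsilon> * (\<Sum>n<N. emeasure M (low n)) \<le> b 0" for N
    proof (induction N)
      case (Suc N)
      have "b (Suc N) + \<epsilon> * (\<Sum>n<Suc N. emeasure M (low n)) = (b (Suc N) + \<epsilon> * emeasure M (low N)) + \<epsilon> * (\<Sum>n<N. emeasure M (low n))"
        by (simp add: algebra_simps)
      also have "\<dots> \<le> b N + \<epsilon> * (\<Sum>n<N. emeasure M (low n))" by (intro add_right_mono step)
      finally show ?case using Suc by simp
    qed simp
    have b0: "b 0 \<le> (\<integral>\<^sup>+\<omega>. h (S m \<omega>) \<partial>M)"
      unfolding b_def by (intro nn_integral_mono) (auto split: split_indicator)
    have "b 0 \<le> (\<integral>\<^sup>+\<omega>. ennreal L \<partial>M)"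
      by (rule order_trans[OF b0], rule nn_integral_mono) (simp add: h_def)
    then have b0L: "b 0 \<le> ennreal L" by (simp add: emeasure_space_1)
    have \<epsilon>0: "\<epsilon> \<noteq> 0" using \<epsilon>(1) by simp
    have "(\<Sum>n. emeasure M (low n)) \<noteq> \<top>"
    proof
      assume top: "(\<Sum>n. emeasure M (low n)) = \<top>"
      have "(SUP N. \<epsilon> * (\<Sum>n<N. emeasure M (low n))) \<le> ennreal L"
        using sum b0L by (intro SUP_least) (meson add_increasing order_refl order_trans zero_le le_add_same_cancel2)
      then have "\<epsilon> * (\<Sum>n. emeasure M (low n)) \<le> ennreal L"
        by (simp add: suminf_eq_SUP SUP_mult_left_ennreal)
      then show False using \<epsilon>0 unfolding top by (auto simp: ennreal_mult_top top_unique)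
    qed
    then have "summable (\<lambda>n. measure M (low n))"
      by (intro summable_suminf_not_top) (simp_all add: emeasure_eq_measure)
    then have "(\<lambda>n. ennreal (measure M (low n))) \<longlonglongrightarrow> ennreal 0"
      by (intro tendsto_ennrealI summable_LIMSEQ_zero)
    then have "(\<lambda>n. emeasure M (low n)) \<longlonglongrightarrow> 0"
      by (simp only: emeasure_eq_measure ennreal_0)
    then have lim: "(\<lambda>n. ennreal L * emeasure M (low n)) \<longlonglongrightarrow> 0"
      using ennreal_tendsto_cmult[of "ennreal L" "\<lambda>n. emeasure M (low n)" 0] by simp
    have "ennreal L * emeasure M (D' m) \<le> b 0 + ennreal L * emeasure M (low n)" for n
    proof -
      have "ennreal L * emeasure M (D' m) = (\<integral>\<^sup>+\<omega>. ennreal L * indicator (D' m) \<omega> \<partial>M)"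
        by (simp add: nn_integral_cmult_indicator)
      also have "\<dots> \<le> (\<integral>\<^sup>+\<omega>. h (S (m+n) \<omega>) * indicator (D m n) \<omega> + ennreal L * indicator (low n) \<omega> \<partial>M)"
      proof (rule nn_integral_mono)
        fix \<omega>
        show "ennreal L * indicator (D' m) \<omega> \<le> h (S (m+n) \<omega>) * indicator (D m n) \<omega> + ennreal L * indicator (low n) \<omega>"
        proof (cases "\<omega> \<in> D' m")
          case True
          then have "\<omega> \<in> D m n" by (auto simp: D_def D'_def)
          moreover have "h (S (m+n) \<omega>) = ennreal L" if "\<not> g (S (m+n) \<omega>) < L"
            using that by (simp add: h_def min_absorb2 ennreal_leI)
          ultimately show ?thesis using True by (cases "g (S (m+n) \<omega>) < L") (simp_all add: low_def)
        qed simp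
      qed
      also have "\<dots> = b n + ennreal L * emeasure M (low n)"
        unfolding b_def by (subst nn_integral_add) (auto simp: nn_integral_cmult_indicator)
      also have "b n \<le> b 0"
        using sum[of n] by (meson le_add_same_cancel1 order_trans zero_le add_increasing2 order_refl)
      finally show ?thesis by (simp add: add_right_mono)
    qed
    then have "ennreal L * emeasure M (D' m) \<le> b 0"
      using tendsto_add[OF tendsto_const[of "b 0"] lim]
      by (intro LIMSEQ_le_const[where X = "\<lambda>n. b 0 + ennreal L * emeasure M (low n)"]) auto
    also note b0
    finally show ?thesis by (simp add: h_def)
  qed
  have "emeasure M (D' m) = 0" for m
  proof -
    define B where "B = (\<lambda>L. \<integral>\<omega>. min (g (S m \<omega>) / L) 1 \<partial>M)"
    have le: "measure M (D' m) \<le> B (real (Suc k))" for k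
    proof -
      define L where "L = real (Suc k)"
      have L: "0 < L" by (simp add: L_def)
      have "ennreal L * emeasure M (D' m) \<le> (\<integral>\<^sup>+\<omega>. ennreal L * ennreal (min (g (S m \<omega>) / L) 1) \<partial>M)"
      proof (rule order_trans[OF bound[of L]])
        show "(\<integral>\<^sup>+\<omega>. min (ennreal (g (S m \<omega>))) (ennreal L) \<partial>M) \<le> (\<integral>\<^sup>+\<omega>. ennreal L * ennreal (min (g (S m \<omega>) / L) 1) \<partial>M)"
          using L g0 by (intro nn_integral_mono) (auto simp: min_def ennreal_mult[symmetric] field_simps)
      qed (use L in simp)
      also have "\<dots> = ennreal L * (\<integral>\<^sup>+\<omega>. ennreal (min (g (S m \<omega>) / L) 1) \<partial>M)"
        by (simp add: nn_integral_cmult)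
      also have "(\<integral>\<^sup>+\<omega>. ennreal (min (g (S m \<omega>) / L) 1) \<partial>M) = ennreal (B L)"
        unfolding B_def using L g0
        by (intro nn_integral_eq_integral integrable_const_bound[where B = 1]) auto
      finally have "emeasure M (D' m) \<le> ennreal (B L)"
        using L by (simp add: ennreal_mult_le_mult_iff)
      moreover have "0 \<le> B L" unfolding B_def using L g0 by (intro integral_nonneg_AE) auto
      ultimately show ?thesis by (simp add: emeasure_eq_measure L_def)
    qed
    have "(\<lambda>k. B (real (Suc k))) \<longlonglongrightarrow> (\<integral>\<omega>. 0 \<partial>M)"
      unfolding B_def
    proof (rule integral_dominated_convergence[where w = "\<lambda>_. 1"])
      show "AE \<omega> in M. (\<lambda>k. min (g (S m \<omega>) / real (Suc k)) 1) \<longlonglongrightarrow> 0"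
      proof (intro AE_I2)
        fix \<omega>
        have "(\<lambda>k. g (S m \<omega>) / real (Suc k)) \<longlonglongrightarrow> 0"
          by (rule LIMSEQ_Suc[OF lim_const_over_n])
        from tendsto_min[OF this tendsto_const[of 1]]
        show "(\<lambda>k. min (g (S m \<omega>) / real (Suc k)) 1) \<longlonglongrightarrow> 0" by simp
      qed
      show "AE \<omega> in M. norm (min (g (S m \<omega>) / real (Suc k)) 1) \<le> 1" for k
        using g0 by auto
    qed auto
    then have "measure M (D' m) \<le> 0"
      using le by (intro LIMSEQ_le_const[where X = "\<lambda>k. B (real (Suc k))"]) auto
    then show ?thesis by (simp add: emeasure_eq_measure measure_le_0_iff)
  qed
  then have "AE \<omega> in M. \<forall>m. \<omega> \<notin> D' m"
    by (intro AE_all_countable[THEN iffD2] allI AE_not_in) (auto simp: null_sets_def)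
  with AE_space show ?thesis
  proof (eventually_elim)
    case (elim \<omega>)
    show ?case
    proof
      assume "finite {n. S n \<omega> = u}"
      then obtain m where "\<And>n. S n \<omega> = u \<Longrightarrow> n < m"
        by (metis (mono_tags, lifting) finite_nat_set_iff_bounded mem_Collect_eq)
      then have "\<omega> \<in> D' m" using elim(1) unfolding D'_def by force
      with elim show False by blast
    qed
  qed
qed

section \<open>The potential kernel of planar simple random walk\<close>

text \<open>
  With \<open>cos \<theta> + cosh s = 2\<close> one has \<open>sinh (s / 2) = sin (\<theta> / 2)\<close>. So \<open>half_sin\<close> is \<open>sinh (s / 2)\<close>,
  \<open>inv_cosh\<close> is \<open>1 / cosh (s / 2)\<close>, \<open>full_sinh\<close> is \<open>sinh s\<close> and \<open>decay\<close> is \<open>exp (- s)\<close>, all of them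
  written as algebraic functions of \<open>sin (\<theta> / 2)\<close>.
\<close>

definition half_sin :: "real \<Rightarrow> real" where "half_sin \<theta> = sin (\<theta> / 2)"
definition inv_cosh :: "real \<Rightarrow> real" where "inv_cosh \<theta> = 1 / sqrt (1 + (half_sin \<theta>)\<^sup>2)"
definition full_sinh :: "real \<Rightarrow> real" where "full_sinh \<theta> = 2 * half_sin \<theta> * sqrt (1 + (half_sin \<theta>)\<^sup>2)"
definition decay :: "real \<Rightarrow> real" where "decay \<theta> = 1 + 2 * (half_sin \<theta>)\<^sup>2 - full_sinh \<theta>"

definition potential_integrand :: "int \<Rightarrow> nat \<Rightarrow> real \<Rightarrow> real" where
  "potential_integrand x y \<theta> = (1 - cos (x * \<theta>) * decay \<theta> ^ y) / full_sinh \<theta>"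

definition potential :: "int \<Rightarrow> nat \<Rightarrow> real" where
  "potential x y = integral {0<..<pi} (potential_integrand x y)"

lemma half_sin_pos:
  assumes "\<theta> \<in> {0<..<pi}" shows "0 < half_sin \<theta>"
  unfolding half_sin_def using assms by (intro sin_gt_zero) auto

lemma sqrt_pos: "0 < sqrt (1 + (half_sin \<theta>)\<^sup>2)"
  by (simp add: add_pos_nonneg)

lemma full_sinh_ge:
  assumes "\<theta> \<in> {0<..<pi}" shows "2 * (half_sin \<theta>)\<^sup>2 \<le> full_sinh \<theta>" "0 < full_sinh \<theta>"
proof -
  have "half_sin \<theta> \<le> sqrt (1 + (half_sin \<theta>)\<^sup>2)"
    by (rule real_le_rsqrt) simp
  then show "2 * (half_sin \<theta>)\<^sup>2 \<le> full_sinh \<theta>"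
    using half_sin_pos[OF assms] by (simp add: full_sinh_def power2_eq_square)
  show "0 < full_sinh \<theta>"
    using half_sin_pos[OF assms] sqrt_pos by (simp add: full_sinh_def)
qed

lemma full_sinh_square: "(full_sinh \<theta>)\<^sup>2 = 4 * (half_sin \<theta>)\<^sup>2 * (1 + (half_sin \<theta>)\<^sup>2)"
  by (simp add: full_sinh_def power_mult_distrib)

lemma cos_half_sin: "cos \<theta> = 1 - 2 * (half_sin \<theta>)\<^sup>2"
  using cos_double_sin[of "\<theta>/2"] by (simp add: half_sin_def)

lemma decay_quadratic: "(decay \<theta>)\<^sup>2 + 1 = decay \<theta> * (4 - 2 * cos \<theta>)"
  unfolding cos_half_sin decay_def using full_sinh_square[of \<theta>] by algebra

lemma decay_bounds:
  assumes "\<theta> \<in> {0<..<pi}" shows "0 \<le> decay \<theta>" "decay \<theta> \<le> 1"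
proof -
  have "decay \<theta> = (sqrt (1 + (half_sin \<theta>)\<^sup>2) - half_sin \<theta>)\<^sup>2"
    by (simp add: decay_def full_sinh_def power2_diff)
  then show "0 \<le> decay \<theta>" by simp
  show "decay \<theta> \<le> 1" using full_sinh_ge[OF assms] by (simp add: decay_def)
qed

lemma abs_sin_multiple_le: "\<bar>sin (of_int n * x)\<bar> \<le> \<bar>of_int n\<bar> * \<bar>sin (x::real)\<bar>" for n :: int
proof -
  have nat: "\<bar>sin (of_nat n * x)\<bar> \<le> of_nat n * \<bar>sin x\<bar>" for n
  proof (induction n)
    case (Suc n)
    have "\<bar>sin (of_nat (Suc n) * x)\<bar> = \<bar>sin (of_nat n * x) * cos x + cos (of_nat n * x) * sin x\<bar>"
      by (simp add: algebra_simps sin_add)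
    also have "\<dots> \<le> \<bar>sin (of_nat n * x)\<bar> * \<bar>cos x\<bar> + \<bar>cos (of_nat n * x)\<bar> * \<bar>sin x\<bar>"
      by (metis abs_mult abs_triangle_ineq)
    also have "\<dots> \<le> \<bar>sin (of_nat n * x)\<bar> * 1 + 1 * \<bar>sin x\<bar>"
      by (intro add_mono mult_mono) auto
    finally show ?case using Suc by (simp add: algebra_simps)
  qed simp
  show ?thesis
  proof (cases n)
    case (nonneg m) then show ?thesis using nat[of m] by simp
  next
    case (neg m) then show ?thesis using nat[of "Suc m"] by (simp del: of_nat_Suc)
  qed
qed

lemma potential_integrand_nonneg:
  assumes "\<theta> \<in> {0<..<pi}" shows "0 \<le> potential_integrand x y \<theta>"
proof -
  have "cos (x * \<theta>) * decay \<theta> ^ y \<le> 1 * 1"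
    using decay_bounds[OF assms] by (intro mult_mono power_le_one) auto
  then show ?thesis using full_sinh_ge[OF assms] by (simp add: potential_integrand_def)
qed

text \<open>
  The integrand is bounded because both \<open>1 - cos (x \<theta>)\<close> and \<open>1 - exp (- s y)\<close> are at most of order
  \<open>sinh s\<close>: the first is \<open>2 sin\<^sup>2 (x \<theta> / 2) \<le> 2 x\<^sup>2 sin\<^sup>2 (\<theta> / 2)\<close>, the second is estimated by Bernoulli's
  inequality. In particular the singularity of \<open>1 / sinh s\<close> at \<open>\<theta> = 0\<close> is harmless.
\<close>

lemma potential_integrand_le:
  assumes "\<theta> \<in> {0<..<pi}" shows "potential_integrand x y \<theta> \<le> (of_int x)\<^sup>2 + of_nat y"
proof -
  define c where "c = cos (x * \<theta>)"
  define q where "q = decay \<theta> ^ y"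
  have q: "0 \<le> q" "q \<le> 1" using decay_bounds[OF assms] by (auto simp: q_def power_le_one)
  have "1 - c * q = (1 - c) + c * (1 - q)" by (simp add: algebra_simps)
  also have "\<dots> \<le> (1 - c) + 1 * (1 - q)"
    using q by (intro add_left_mono mult_right_mono) (auto simp: c_def)
  also have "1 - c \<le> (of_int x)\<^sup>2 * full_sinh \<theta>"
  proof -
    have "1 - c = 2 * (sin (of_int x * (\<theta>/2)))\<^sup>2"
      using cos_double_sin[of "of_int x * (\<theta>/2)"] by (simp add: c_def)
    also have "\<dots> \<le> 2 * (\<bar>of_int x\<bar> * \<bar>half_sin \<theta>\<bar>)\<^sup>2"
      using abs_sin_multiple_le[of x "\<theta>/2"] unfolding half_sin_def
      by (metis abs_ge_zero mult_left_mono power2_abs power_mono zero_le_numeral)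
    also have "\<dots> = (of_int x)\<^sup>2 * (2 * (half_sin \<theta>)\<^sup>2)"
      by (simp add: power_mult_distrib)
    also have "\<dots> \<le> (of_int x)\<^sup>2 * full_sinh \<theta>"
      using full_sinh_ge[OF assms] by (intro mult_left_mono) auto
    finally show ?thesis .
  qed
  also have "1 * (1 - q) \<le> of_nat y * full_sinh \<theta>"
  proof -
    have "1 + of_nat y * (decay \<theta> - 1) \<le> (1 + (decay \<theta> - 1)) ^ y"
      using decay_bounds[OF assms] by (intro Bernoulli_inequality) auto
    then have "1 - q \<le> of_nat y * (1 - decay \<theta>)"
      by (simp add: q_def algebra_simps)
    also have "\<dots> \<le> of_nat y * full_sinh \<theta>"
      by (intro mult_left_mono) (auto simp: decay_def)
    finally show ?thesis by simp
  qed
  finally have "1 - c * q \<le> ((of_int x)\<^sup>2 + of_nat y) * full_sinh \<theta>"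
    by (simp add: algebra_simps)
  then show ?thesis
    using full_sinh_ge[OF assms] by (simp add: potential_integrand_def c_def q_def divide_le_eq)
qed

lemma potential_integrand_integrable: "potential_integrand x y integrable_on {0<..<pi}"
proof -
  have [measurable]: "potential_integrand x y \<in> borel_measurable borel"
    unfolding potential_integrand_def decay_def full_sinh_def half_sin_def by measurable
  have "set_integrable lborel {0<..<pi} (potential_integrand x y)"
    unfolding set_integrable_def
  proof (rule integrableI_bounded_set_indicator[where B = "(of_int x)\<^sup>2 + of_nat y"])
    show "AE \<theta> in lborel. \<theta> \<in> {0<..<pi} \<longrightarrow> norm (potential_integrand x y \<theta>) \<le> (of_int x)\<^sup>2 + of_nat y"
      using potential_integrand_nonneg potential_integrand_le by (auto intro!: AE_I2)
  qed (auto simp: emeasure_lborel_Ioo)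
  then show ?thesis by (rule set_borel_integral_eq_integral)
qed

lemma potential_nonneg: "0 \<le> potential x y"
  unfolding potential_def using potential_integrand_nonneg by (intro integral_nonneg potential_integrand_integrable)

lemma potential_minus: "potential (- x) y = potential x y"
  by (simp add: potential_def potential_integrand_def[abs_def])

lemma cos_shift_sum:
  "cos (of_int (x + 1) * \<theta>) + cos (of_int (x - 1) * \<theta>) = 2 * cos \<theta> * cos (of_int x * (\<theta>::real))"
  by (simp add: algebra_simps cos_add cos_diff)

text \<open>
  The integrand itself is harmonic in \<open>(x, y)\<close> off the axis: averaging over horizontal neighbours
  multiplies \<open>cos (x \<theta>)\<close> by \<open>cos \<theta>\<close>, averaging over vertical ones multiplies \<open>exp (- s y)\<close> by \<open>cosh s\<close>,
  and \<open>cos \<theta> + cosh s = 2\<close>.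
\<close>

lemma potential_harmonic_off_axis:
  "potential (x + 1) (Suc y) + potential (x - 1) (Suc y) + potential x (Suc (Suc y)) + potential x y = 4 * potential x (Suc y)"
proof -
  have "integral {0<..<pi} (\<lambda>\<theta>. potential_integrand (x + 1) (Suc y) \<theta> + potential_integrand (x - 1) (Suc y) \<theta> + potential_integrand x (Suc (Suc y)) \<theta> + potential_integrand x y \<theta>)
      = integral {0<..<pi} (\<lambda>\<theta>. 4 * potential_integrand x (Suc y) \<theta>)"
  proof (rule integral_cong)
    fix \<theta> :: real assume "\<theta> \<in> {0<..<pi}"
    define q where "q = decay \<theta> ^ y"
    define c where "c = cos (x * \<theta>)"
    have eq: "cos (of_int (x + 1) * \<theta>) = 2 * cos \<theta> * c - cos (of_int (x - 1) * \<theta>)"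
      using cos_shift_sum[of x \<theta>] by (simp add: c_def)
    have "(1 - cos (of_int (x + 1) * \<theta>) * (decay \<theta> * q)) + (1 - cos (of_int (x - 1) * \<theta>) * (decay \<theta> * q))
       + (1 - c * (decay \<theta> * (decay \<theta> * q))) + (1 - c * q) = 4 * (1 - c * (decay \<theta> * q))"
      unfolding eq using decay_quadratic[of \<theta>] by algebra
    then show "potential_integrand (x + 1) (Suc y) \<theta> + potential_integrand (x - 1) (Suc y) \<theta> + potential_integrand x (Suc (Suc y)) \<theta> + potential_integrand x y \<theta> = 4 * potential_integrand x (Suc y) \<theta>"
      unfolding potential_integrand_def q_def c_def power_Suc add_divide_distrib[symmetric] by simp
  qed
  then show ?thesis
    by (simp add: potential_def integral_add potential_integrand_integrable integrable_add)
qed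

lemma integral_cos_zero:
  assumes "x \<noteq> 0" shows "integral {0<..<pi} (\<lambda>\<theta>. cos (of_int x * \<theta>)) = 0"
proof -
  have "((\<lambda>\<theta>. cos (of_int x * \<theta>)) has_integral
     (sin (of_int x * pi) / of_int x - sin (of_int x * 0) / of_int x)) {0..pi}"
    using assms by (intro fundamental_theorem_of_calculus)
      (auto intro!: derivative_eq_intros simp flip: has_real_derivative_iff_has_vector_derivative)
  moreover have "sin (of_int x * pi) = 0"
    by (subst sin_times_pi_eq_0) simp
  ultimately have "((\<lambda>\<theta>. cos (of_int x * \<theta>)) has_integral 0) {0..pi}"
    by simp
  then show ?thesis
    by (metis integral_open_interval_real integral_unique)
qed

text \<open>
  By the reflection \<open>y \<mapsto> - y\<close> the two vertical neighbours of \<open>(x, 0)\<close> contribute \<open>2 potential x 1\<close>. The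
  integrand fails to be harmonic here, but its defect is \<open>2 cos (x \<theta>)\<close>, which integrates to zero.
\<close>

lemma potential_harmonic_on_axis:
  assumes "x \<noteq> 0"
  shows "potential (x + 1) 0 + potential (x - 1) 0 + 2 * potential x 1 = 4 * potential x 0"
proof -
  have "integral {0<..<pi} (\<lambda>\<theta>. potential_integrand (x + 1) 0 \<theta> + potential_integrand (x - 1) 0 \<theta> + 2 * potential_integrand x 1 \<theta> - 4 * potential_integrand x 0 \<theta>)
      = integral {0<..<pi} (\<lambda>\<theta>. 2 * cos (of_int x * \<theta>))"
  proof (rule integral_cong)
    fix \<theta> :: real assume \<theta>: "\<theta> \<in> {0<..<pi}"
    define c where "c = cos (x * \<theta>)"
    have eq: "cos (of_int (x + 1) * \<theta>) = 2 * cos \<theta> * c - cos (of_int (x - 1) * \<theta>)"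
      using cos_shift_sum[of x \<theta>] by (simp add: c_def)
    have "(1 - cos (of_int (x + 1) * \<theta>)) + (1 - cos (of_int (x - 1) * \<theta>))
       + 2 * (1 - c * decay \<theta>) - 4 * (1 - c) = 2 * c * full_sinh \<theta>"
      unfolding eq decay_def cos_half_sin[of \<theta>] by algebra
    moreover have "potential_integrand (x + 1) 0 \<theta> + potential_integrand (x - 1) 0 \<theta> + 2 * potential_integrand x 1 \<theta> - 4 * potential_integrand x 0 \<theta>
       = ((1 - cos (of_int (x + 1) * \<theta>)) + (1 - cos (of_int (x - 1) * \<theta>))
       + 2 * (1 - c * decay \<theta>) - 4 * (1 - c)) / full_sinh \<theta>"
      by (simp add: potential_integrand_def c_def add_divide_distrib diff_divide_distrib)
    ultimately show "potential_integrand (x + 1) 0 \<theta> + potential_integrand (x - 1) 0 \<theta> + 2 * potential_integrand x 1 \<theta> - 4 * potential_integrand x 0 \<theta> = 2 * cos (of_int x * \<theta>)"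
      using full_sinh_ge[OF \<theta>] by (simp add: c_def)
  qed
  also have "\<dots> = 0" using integral_cos_zero[OF assms] by simp
  finally show ?thesis
    by (simp add: potential_def integral_add integral_diff potential_integrand_integrable integrable_add)
qed

lemma half_sin_deriv: "(half_sin has_real_derivative cos (\<theta>/2) / 2) (at \<theta> within A)"
  unfolding half_sin_def[abs_def] by (auto intro!: derivative_eq_intros)

lemma inv_cosh_pos: "0 < inv_cosh \<theta>" using sqrt_pos by (simp add: inv_cosh_def)

lemma inv_cosh_square: "(inv_cosh \<theta>)\<^sup>2 * (1 + (half_sin \<theta>)\<^sup>2) = 1"
proof -
  have "0 < 1 + (half_sin \<theta>)\<^sup>2" by (simp add: add_pos_nonneg)
  then show ?thesis by (simp add: inv_cosh_def power_divide)
qed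

lemma inv_cosh_deriv: "(inv_cosh has_real_derivative - (half_sin \<theta> * cos (\<theta>/2) * inv_cosh \<theta> ^ 3 / 2)) (at \<theta> within A)"
proof -
  define q where "q = sqrt (1 + (half_sin \<theta>)\<^sup>2)"
  have q: "0 < q" using sqrt_pos by (simp add: q_def)
  have pos: "0 < 1 + (half_sin \<theta>)\<^sup>2" by (simp add: add_pos_nonneg)
  have "((\<lambda>\<theta>. 1 + (half_sin \<theta>)\<^sup>2) has_real_derivative half_sin \<theta> * cos (\<theta>/2)) (at \<theta> within A)"
    by (rule DERIV_cong[OF DERIV_add[OF DERIV_const DERIV_power[OF half_sin_deriv]]]) simp
  from DERIV_chain2[OF DERIV_real_sqrt[OF pos] this]
  have "((\<lambda>\<theta>. sqrt (1 + (half_sin \<theta>)\<^sup>2)) has_real_derivative inverse q / 2 * (half_sin \<theta> * cos (\<theta>/2))) (at \<theta> within A)"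
    by (simp add: q_def)
  from DERIV_inverse_fun[OF this, folded q_def]
  have "((\<lambda>\<theta>. inverse (sqrt (1 + (half_sin \<theta>)\<^sup>2))) has_real_derivative
      - (inverse q / 2 * (half_sin \<theta> * cos (\<theta>/2)) * inverse (q ^ Suc (Suc 0)))) (at \<theta> within A)"
    using q by simp
  moreover have "(\<lambda>\<theta>. inverse (sqrt (1 + (half_sin \<theta>)\<^sup>2))) = inv_cosh"
    by (simp add: inv_cosh_def fun_eq_iff inverse_eq_divide)
  moreover have "- (inverse q / 2 * (half_sin \<theta> * cos (\<theta>/2)) * inverse (q ^ Suc (Suc 0))) = - (half_sin \<theta> * cos (\<theta>/2) * inv_cosh \<theta> ^ 3 / 2)"
    using q by (simp add: inv_cosh_def q_def[symmetric] power3_eq_cube field_simps)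
  ultimately show ?thesis by (simp only:)
qed

lemma cos_mult_deriv: "((\<lambda>t. cos (c * t)) has_real_derivative - (c * sin (c * \<theta>))) (at \<theta> within A)"
  by (auto intro!: derivative_eq_intros)

lemma sin_mult_deriv: "((\<lambda>t. sin (c * t)) has_real_derivative c * cos (c * \<theta>)) (at \<theta> within A)" for c :: real
  by (auto intro!: derivative_eq_intros)

text \<open>
  The two estimates below need integrals of oscillating functions, for which integration by parts
  gives a primitive up to a remainder of known sign.
\<close>

lemma integral_open_FTC_le:
  fixes F :: "real \<Rightarrow> real"
  assumes "a \<le> b" "\<And>t. t \<in> {a..b} \<Longrightarrow> (F has_real_derivative F' t) (at t within {a..b})"
    and "f integrable_on {a<..<b}" "\<And>t. t \<in> {a<..<b} \<Longrightarrow> f t \<le> F' t"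
  shows "integral {a<..<b} f \<le> F b - F a"
proof -
  have *: "(F' has_integral (F b - F a)) {a..b}"
    using assms by (intro fundamental_theorem_of_calculus) (auto simp flip: has_real_derivative_iff_has_vector_derivative)
  then have "integral {a<..<b} f \<le> integral {a<..<b} F'"
    using assms by (intro integral_le) (auto simp: integrable_on_open_interval_real)
  also have "\<dots> = F b - F a"
    using integral_open_interval_real[of a b F'] integral_unique[OF *] by simp
  finally show ?thesis .
qed

text \<open>
  The second difference is the integral of \<open>2 cos (x \<theta>) \<rho> \<theta>\<close> with \<open>\<rho> = tanh (s / 2)\<close>, that is,
  \<open>half_sin * inv_cosh\<close>. This \<open>\<rho>\<close> is concave on \<open>[0, \<pi>]\<close> with \<open>\<rho>' \<pi> = 0\<close>, and cosine coefficients of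
  such a function are nonpositive: two integrations by parts leave the integral
  of \<open>(1 - cos (x \<theta>)) \<rho>'' \<theta> / x\<^sup>2\<close>.
\<close>

lemma potential_concave:
  assumes "x \<noteq> 0"
  shows "potential (x + 1) 0 + potential (x - 1) 0 \<le> 2 * potential x 0"
proof -
  define X :: real where "X = of_int x"
  have X: "X \<noteq> 0" using assms by (simp add: X_def)
  \<comment> \<open>\<open>F\<close> collects the boundary terms of the two integrations by parts and \<open>G\<close> is \<open>\<rho>''\<close>.\<close>
  define F where "F = (\<lambda>\<theta>. 2 * (inverse X * (sin (X * \<theta>) * (half_sin \<theta> * inv_cosh \<theta>)) - (inverse X)\<^sup>2 * ((1 - cos (X * \<theta>)) * (cos (\<theta>/2) * inv_cosh \<theta> ^ 3 / 2))))"
  define G where "G = (\<lambda>\<theta>. - half_sin \<theta> * inv_cosh \<theta> ^ 3 / 4 - 3 * (cos (\<theta>/2))\<^sup>2 * half_sin \<theta> * inv_cosh \<theta> ^ 5 / 4)"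
  have "integral {0<..<pi} (\<lambda>\<theta>. potential_integrand (x + 1) 0 \<theta> + potential_integrand (x - 1) 0 \<theta> - 2 * potential_integrand x 0 \<theta>) \<le> F pi - F 0"
  proof (rule integral_open_FTC_le)
    show "(\<lambda>\<theta>. potential_integrand (x + 1) 0 \<theta> + potential_integrand (x - 1) 0 \<theta> - 2 * potential_integrand x 0 \<theta>) integrable_on {0<..<pi}"
      by (intro integrable_add integrable_diff integrable_on_mult_right potential_integrand_integrable)
    fix \<theta> :: real
    have 1: "((\<lambda>\<theta>. half_sin \<theta> * inv_cosh \<theta>) has_real_derivative cos (\<theta>/2) * inv_cosh \<theta> ^ 3 / 2) (at \<theta> within {0..pi})"
    proof -
      have "cos (\<theta> / 2) / 2 * inv_cosh \<theta> + - (half_sin \<theta> * cos (\<theta> / 2) * inv_cosh \<theta> ^ 3 / 2) * half_sin \<theta> = cos (\<theta> / 2) * inv_cosh \<theta> ^ 3 / 2"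
        using inv_cosh_square[of \<theta>] by algebra
      then show ?thesis
        by (rule DERIV_cong[OF DERIV_mult[OF half_sin_deriv inv_cosh_deriv]])
    qed
    have 2: "((\<lambda>\<theta>. cos (\<theta>/2) * inv_cosh \<theta> ^ 3 / 2) has_real_derivative G \<theta>) (at \<theta> within {0..pi})"
    proof -
      have 3: "((\<lambda>t. cos (t / 2) / 2) has_real_derivative - half_sin \<theta> / 4) (at \<theta> within {0..pi})"
        by (auto intro!: derivative_eq_intros simp: half_sin_def)
      have "((\<lambda>t. cos (t/2) / 2 * inv_cosh t ^ 3) has_real_derivative G \<theta>) (at \<theta> within {0..pi})"
        by (rule DERIV_cong[OF DERIV_mult[OF 3 DERIV_power[OF inv_cosh_deriv]]])
          (simp add: G_def algebra_simps power2_eq_square eval_nat_numeral)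
      then show ?thesis by simp
    qed
    show "(F has_real_derivative 2 * (cos (X * \<theta>) * (half_sin \<theta> * inv_cosh \<theta>) - (inverse X)\<^sup>2 * ((1 - cos (X * \<theta>)) * G \<theta>))) (at \<theta> within {0..pi})"
      unfolding F_def
      by (rule DERIV_cong[OF DERIV_cmult[OF DERIV_diff[OF DERIV_cmult[OF DERIV_mult[OF sin_mult_deriv 1]]
            DERIV_cmult[OF DERIV_mult[OF DERIV_diff[OF DERIV_const cos_mult_deriv] 2]]]]])
        (use X right_inverse[OF X] in algebra)
    assume \<theta>: "\<theta> \<in> {0<..<pi}"
    have "G \<theta> \<le> 0"
    proof -
      have "0 \<le> half_sin \<theta> * inv_cosh \<theta> ^ 3" "0 \<le> (cos (\<theta>/2))\<^sup>2 * half_sin \<theta> * inv_cosh \<theta> ^ 5"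
        using half_sin_pos[OF \<theta>] inv_cosh_pos[of \<theta>] by (auto intro!: mult_nonneg_nonneg less_imp_le)
      then show ?thesis by (simp add: G_def)
    qed
    then have "(inverse X)\<^sup>2 * ((1 - cos (X * \<theta>)) * G \<theta>) \<le> 0"
      by (simp add: mult_nonneg_nonpos)
    moreover have "potential_integrand (x + 1) 0 \<theta> + potential_integrand (x - 1) 0 \<theta> - 2 * potential_integrand x 0 \<theta> = 2 * (cos (X * \<theta>) * (half_sin \<theta> * inv_cosh \<theta>))"
    proof -
      have "potential_integrand (x + 1) 0 \<theta> + potential_integrand (x - 1) 0 \<theta> - 2 * potential_integrand x 0 \<theta>
          = (2 * cos (X * \<theta>) - (cos (of_int (x + 1) * \<theta>) + cos (of_int (x - 1) * \<theta>))) / full_sinh \<theta>"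
        by (simp add: potential_integrand_def X_def add_divide_distrib diff_divide_distrib)
      also have "\<dots> = 4 * (half_sin \<theta>)\<^sup>2 * cos (X * \<theta>) / full_sinh \<theta>"
        unfolding cos_shift_sum cos_half_sin[of \<theta>] by (simp add: X_def algebra_simps)
      also have "\<dots> = 2 * (cos (X * \<theta>) * (half_sin \<theta> * inv_cosh \<theta>))"
        using half_sin_pos[OF \<theta>] by (simp add: full_sinh_def inv_cosh_def power2_eq_square)
      finally show ?thesis .
    qed
    ultimately show "potential_integrand (x + 1) 0 \<theta> + potential_integrand (x - 1) 0 \<theta> - 2 * potential_integrand x 0 \<theta>
       \<le> 2 * (cos (X * \<theta>) * (half_sin \<theta> * inv_cosh \<theta>) - (inverse X)\<^sup>2 * ((1 - cos (X * \<theta>)) * G \<theta>))"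
      by (simp only: right_diff_distrib)
  qed simp
  also have "F pi - F 0 = 0"
    using assms by (simp add: F_def X_def sin_times_pi_eq_0)
  finally show ?thesis
    by (simp add: potential_def integral_add integral_diff potential_integrand_integrable integrable_add)
qed

text \<open>
  The increment is the integral of \<open>sin (c \<theta>) inv_cosh \<theta>\<close> with \<open>c = n + 1 / 2\<close>. As \<open>inv_cosh\<close> is
  decreasing, one integration by parts bounds it below by the boundary term
  \<open>(1 - cos (c \<pi>)) inv_cosh \<pi> / c\<close>, and \<open>cos (c \<pi>) = 0\<close>.
\<close>

lemma potential_increment:
  fixes n :: nat
  shows "potential (int n) 0 + 1 / (2 * of_nat (Suc n)) \<le> potential (int (Suc n)) 0"
proof -
  define c :: real where "c = of_nat n + 1/2"
  have c: "0 < c" by (simp add: c_def add_nonneg_pos)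
  then have ic: "c * inverse c = 1" by simp
  define F where "F = (\<lambda>\<theta>. - (inverse c * ((1 - cos (c * \<theta>)) * inv_cosh \<theta>)))"
  have "integral {0<..<pi} (\<lambda>\<theta>. potential_integrand (int n) 0 \<theta> - potential_integrand (int (Suc n)) 0 \<theta>) \<le> F pi - F 0"
  proof (rule integral_open_FTC_le)
    show "(\<lambda>\<theta>. potential_integrand (int n) 0 \<theta> - potential_integrand (int (Suc n)) 0 \<theta>) integrable_on {0<..<pi}"
      by (intro integrable_diff potential_integrand_integrable)
    fix \<theta> :: real
    show "(F has_real_derivative - (sin (c * \<theta>) * inv_cosh \<theta> - inverse c * ((1 - cos (c * \<theta>)) * (half_sin \<theta> * cos (\<theta>/2) * inv_cosh \<theta> ^ 3 / 2)))) (at \<theta> within {0..pi})"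
      unfolding F_def
      by (rule DERIV_cong[OF DERIV_minus[OF DERIV_cmult[OF DERIV_mult[OF DERIV_diff[OF DERIV_const cos_mult_deriv] inv_cosh_deriv]]]])
        (use ic in algebra)
    assume \<theta>: "\<theta> \<in> {0<..<pi}"
    have "0 \<le> cos (\<theta>/2)" using \<theta> by (intro cos_ge_zero) auto
    then have "0 \<le> inverse c * ((1 - cos (c * \<theta>)) * (half_sin \<theta> * cos (\<theta>/2) * inv_cosh \<theta> ^ 3 / 2))"
      using half_sin_pos[OF \<theta>] inv_cosh_pos[of \<theta>] c by (intro mult_nonneg_nonneg divide_nonneg_nonneg) auto
    moreover have "potential_integrand (int n) 0 \<theta> - potential_integrand (int (Suc n)) 0 \<theta> = - (sin (c * \<theta>) * inv_cosh \<theta>)"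
    proof -
      have "potential_integrand (int n) 0 \<theta> - potential_integrand (int (Suc n)) 0 \<theta>
          = (cos (c * \<theta> + \<theta>/2) - cos (c * \<theta> - \<theta>/2)) / full_sinh \<theta>"
      proof -
        have "c * \<theta> + \<theta>/2 = real (Suc n) * \<theta>" "c * \<theta> - \<theta>/2 = real n * \<theta>"
          by (simp_all add: c_def distrib_right)
        then show ?thesis by (simp add: potential_integrand_def diff_divide_distrib del: of_nat_Suc)
      qed
      also have "\<dots> = - (2 * sin (c * \<theta>) * half_sin \<theta>) / full_sinh \<theta>"
        by (simp add: cos_add cos_diff half_sin_def)
      also have "\<dots> = - (sin (c * \<theta>) * inv_cosh \<theta>)"
        using half_sin_pos[OF \<theta>] by (simp add: full_sinh_def inv_cosh_def)
      finally show ?thesis .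
    qed
    ultimately show "potential_integrand (int n) 0 \<theta> - potential_integrand (int (Suc n)) 0 \<theta>
      \<le> - (sin (c * \<theta>) * inv_cosh \<theta> - inverse c * ((1 - cos (c * \<theta>)) * (half_sin \<theta> * cos (\<theta>/2) * inv_cosh \<theta> ^ 3 / 2)))"
      by linarith
  qed simp
  also have "F pi - F 0 = - (inv_cosh pi / c)"
  proof -
    have "c * pi = real n * pi + pi / 2" by (simp add: c_def distrib_right)
    then have "cos (c * pi) = 0" by (simp add: cos_add)
    then show ?thesis by (simp add: F_def divide_inverse)
  qed
  also have "\<dots> \<le> - (1 / (2 * of_nat (Suc n)))"
  proof -
    have "sqrt 2 \<le> 2" by (rule real_le_lsqrt) auto
    then have half: "1 / 2 \<le> inv_cosh pi" by (simp add: inv_cosh_def half_sin_def field_simps)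
    have "(1 / 2) / of_nat (Suc n) \<le> inv_cosh pi / c"
      by (rule frac_le) (use c inv_cosh_pos[of pi] half in \<open>simp_all add: c_def\<close>)
    then show ?thesis by simp
  qed
  finally show ?thesis
    by (simp add: potential_def integral_diff potential_integrand_integrable)
qed

lemma potential_ge_harm: "harm n / 2 \<le> potential (int n) 0"
proof (induction n)
  case 0 show ?case by (simp add: harm_expand potential_nonneg)
next
  case (Suc n)
  have "harm (Suc n) / 2 = (harm n / 2 + 1 / (2 * of_nat (Suc n)) :: real)"
    by (simp only: harm_Suc add_divide_distrib) (simp add: inverse_eq_divide)
  then show ?case using Suc.IH potential_increment[of n] by linarith
qed

lemma finite_potential_sublevel: "finite {x. potential x 0 < L}"
proof -
  obtain N where N: "\<And>n. n \<ge> N \<Longrightarrow> 2 * L \<le> harm n"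
    using harm_at_top unfolding filterlim_at_top eventually_sequentially by meson
  have "{x. potential x 0 < L} \<subseteq> {- int N..int N}"
  proof
    fix x assume "x \<in> {x. potential x 0 < L}"
    moreover have "potential x 0 = potential (int (nat \<bar>x\<bar>)) 0"
      using potential_minus[of x 0] by (simp add: abs_if)
    ultimately have "harm (nat \<bar>x\<bar>) < 2 * L" using potential_ge_harm[of "nat \<bar>x\<bar>"] by simp
    then have "\<not> N \<le> nat \<bar>x\<bar>" using N not_less by blast
    then show "x \<in> {- int N..int N}" by auto
  qed
  then show ?thesis by (rule finite_subset) simp
qed

section \<open>First step analysis for planar simple random walk\<close>

abbreviation steps :: "(int \<times> int) set" where
  "steps \<equiv> {(1, 0), (-1, 0), (0, 1), (0, -1)}"

lemma srw_coordinate_measurable: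
  "(\<lambda>\<omega>. f (\<omega> k)) \<in> srw_space \<rightarrow>\<^sub>M count_space UNIV"
  unfolding srw_space_def
  by (rule measurable_compose[OF measurable_component_singleton]) auto

lemma srw_U_measurable [measurable]: "srw_U n \<in> srw_space \<rightarrow>\<^sub>M count_space UNIV"
proof (induction n)
  case (Suc n)
  have "srw_U (Suc n) = (\<lambda>\<omega>. srw_U n \<omega> + fst (\<omega> n))" by (simp add: srw_U_def fun_eq_iff)
  then show ?case using Suc srw_coordinate_measurable[of fst n] by simp measurable
qed (simp add: srw_U_def[abs_def])

lemma srw_V_measurable [measurable]: "srw_V n \<in> srw_space \<rightarrow>\<^sub>M count_space UNIV"
proof (induction n)
  case (Suc n)
  have "srw_V (Suc n) = (\<lambda>\<omega>. srw_V n \<omega> + snd (\<omega> n))" by (simp add: srw_V_def fun_eq_iff)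
  then show ?case using Suc srw_coordinate_measurable[of snd n] by simp measurable
qed (simp add: srw_V_def[abs_def])

lemma prob_space_srw: "prob_space srw_space"
  unfolding srw_space_def by (intro prob_space_PiM prob_space_measure_pmf)

lemma ennreal_4_times_divide: "4 * (a / 4) = (a :: ennreal)"
  by (simp add: ennreal_times_divide mult.commute[of 4] mult_divide_eq_ennreal)

lemma ennreal_mult_4_le_cancel: "4 * a \<le> 4 * b \<Longrightarrow> a \<le> (b :: ennreal)"
  using ennreal_mult_le_mult_iff[of 4 a b] by simp

lemma four_steps: "(\<Sum>s\<in>steps. b (u + fst s) (v + snd s)) = b (u + 1) v + b (u - 1) v + b u (v + 1) + b u (v - 1 :: int)"
  for b :: "int \<Rightarrow> int \<Rightarrow> real"
  by (simp add: add.assoc)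

text \<open>
  After its first step the walk is again a simple random walk. The factor 4 on the left avoids
  a division in \<open>ennreal\<close>.
\<close>

lemma srw_first_step:
  assumes F: "F \<in> borel_measurable srw_space"
  shows "4 * (\<integral>\<^sup>+\<omega>. F \<omega> \<partial>srw_space) = (\<Sum>s\<in>steps. \<integral>\<^sup>+\<omega>. F (case_nat s \<omega>) \<partial>srw_space)"
proof -
  interpret sequence_space "measure_pmf srw_increment" by unfold_locales
  have S: "S = srw_space" by (simp add: srw_space_def)
  have [measurable]: "F \<in> borel_measurable S" using F S by simp
  have "(\<integral>\<^sup>+\<omega>. F \<omega> \<partial>S) = (\<integral>\<^sup>+\<omega>. F \<omega> \<partial>distr (measure_pmf srw_increment \<Otimes>\<^sub>M S) S (\<lambda>(s, \<omega>). case_nat s \<omega>))"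
    by (simp add: PiM_iter)
  also have "\<dots> = (\<integral>\<^sup>+p. F (case_nat (fst p) (snd p)) \<partial>(measure_pmf srw_increment \<Otimes>\<^sub>M S))"
    by (subst nn_integral_distr) (auto simp: case_prod_beta)
  also have "\<dots> = (\<integral>\<^sup>+s. \<integral>\<^sup>+\<omega>. F (case_nat s \<omega>) \<partial>S \<partial>measure_pmf srw_increment)"
    by (subst nn_integral_fst[symmetric]) auto
  also have "\<dots> = (\<Sum>s\<in>steps. \<integral>\<^sup>+\<omega>. F (case_nat s \<omega>) \<partial>S) / 4"
    unfolding srw_increment_def by (subst nn_integral_pmf_of_set) auto
  finally have "4 * (\<integral>\<^sup>+\<omega>. F \<omega> \<partial>S) = 4 * ((\<Sum>s\<in>steps. \<integral>\<^sup>+\<omega>. F (case_nat s \<omega>) \<partial>S) / 4)"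
    by simp
  also have "\<dots> = (\<Sum>s\<in>steps. \<integral>\<^sup>+\<omega>. F (case_nat s \<omega>) \<partial>S)"
    by (rule ennreal_4_times_divide)
  finally show ?thesis unfolding S .
qed

lemma srw_case_nat:
  "srw_U 0 \<omega> = 0" "srw_V 0 \<omega> = 0"
  "srw_U (Suc n) (case_nat s \<omega>) = fst s + srw_U n \<omega>"
  "srw_V (Suc n) (case_nat s \<omega>) = snd s + srw_V n \<omega>"
  by (simp_all add: srw_U_def srw_V_def sum.lessThan_Suc_shift del: sum.lessThan_Suc)

section \<open>Almost sure return to the axis\<close>

definition never_hit :: "int \<Rightarrow> (nat \<Rightarrow> int \<times> int) set" where
  "never_hit v = {\<omega> \<in> space srw_space. \<forall>n. v + srw_V n \<omega> \<noteq> 0}"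

lemma never_hit_sets [measurable]: "never_hit v \<in> sets srw_space"
  unfolding never_hit_def by measurable

lemma never_hit_case_nat:
  assumes "v \<noteq> 0" "\<omega> \<in> space srw_space"
  shows "case_nat s \<omega> \<in> never_hit v \<longleftrightarrow> \<omega> \<in> never_hit (v + snd s)"
proof -
  have sp: "space srw_space = UNIV" by (simp add: srw_space_def space_PiM)
  have "(\<forall>n. v + srw_V n (case_nat s \<omega>) \<noteq> 0) \<longleftrightarrow> (\<forall>n. v + snd s + srw_V n \<omega> \<noteq> 0)"
    (is "?l \<longleftrightarrow> ?r")
  proof
    assume ?l
    show ?r
    proof
      fix n show "v + snd s + srw_V n \<omega> \<noteq> 0"
        using \<open>?l\<close>[rule_format, of "Suc n"] by (simp add: srw_case_nat add.assoc)
    qed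
  next
    assume ?r
    show ?l
    proof
      fix n show "v + srw_V n (case_nat s \<omega>) \<noteq> 0"
        using \<open>?r\<close>[rule_format, of "n - 1"] assms(1)
        by (cases n) (simp_all add: srw_case_nat add.assoc)
    qed
  qed
  then show ?thesis by (simp add: never_hit_def sp)
qed

lemma never_hit_average:
  assumes "v \<noteq> 0"
  shows "2 * measure srw_space (never_hit v) = measure srw_space (never_hit (v + 1)) + measure srw_space (never_hit (v - 1))"
proof -
  interpret prob_space srw_space by (rule prob_space_srw)
  have "4 * emeasure srw_space (never_hit v) = 4 * (\<integral>\<^sup>+\<omega>. indicator (never_hit v) \<omega> \<partial>srw_space)"
    by simp
  also have "\<dots> = (\<Sum>s\<in>steps. \<integral>\<^sup>+\<omega>. indicator (never_hit v) (case_nat s \<omega>) \<partial>srw_space)"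
    by (rule srw_first_step) simp
  also have "\<dots> = (\<Sum>s\<in>steps. \<integral>\<^sup>+\<omega>. indicator (never_hit (v + snd s)) \<omega> \<partial>srw_space)"
    using assms by (intro sum.cong refl nn_integral_cong) (simp add: never_hit_case_nat indicator_def)
  also have "\<dots> = (\<Sum>s\<in>steps. emeasure srw_space (never_hit (v + snd s)))" by simp
  finally have "4 * emeasure srw_space (never_hit v) = (\<Sum>s\<in>steps. emeasure srw_space (never_hit (v + snd s)))" .
  then have "ennreal (4 * measure srw_space (never_hit v)) = ennreal (\<Sum>s\<in>steps. measure srw_space (never_hit (v + snd s)))"
    by (simp add: emeasure_eq_measure ennreal_mult flip: ennreal_plus)
  then have "4 * measure srw_space (never_hit v) = (\<Sum>s\<in>steps. measure srw_space (never_hit (v + snd s)))"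
    by (subst (asm) ennreal_inj) (auto intro!: sum_nonneg add_nonneg_nonneg)
  then show ?thesis by simp
qed

text \<open>
  The relation forces \<open>p\<close> to be linear, and a bounded linear sequence starting at zero vanishes.
  With the probabilities of never reaching height zero for \<open>p\<close>, this shows that the vertical
  component of the walk is recurrent.
\<close>

lemma bounded_linear_recurrence_zero:
  fixes p :: "nat \<Rightarrow> real"
  assumes "p 0 = 0" and "\<And>n. 2 * p (Suc n) = p (Suc (Suc n)) + p n"
    and "\<And>n. 0 \<le> p n" "\<And>n. p n \<le> 1"
  shows "p n = 0"
proof -
  have lin: "p n = of_nat n * p 1 \<and> p (Suc n) = of_nat (Suc n) * p 1" for n
  proof (induction n)
    case (Suc n)
    then show ?case using assms(2)[of n] by (simp add: algebra_simps)
  qed (simp add: assms(1))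
  have "p 1 \<le> 0"
  proof (rule ccontr)
    assume "\<not> p 1 \<le> 0"
    then obtain N where "1 < of_nat N * p 1" using ex_less_of_nat_mult[of "p 1" 1] by auto
    then show False using assms(4)[of N] lin[of N] by simp
  qed
  then show ?thesis using lin[of n] assms(3)[of 1] by simp
qed

lemma never_hit_null: "measure srw_space (never_hit v) = 0"
proof -
  have bounds: "0 \<le> measure srw_space (never_hit v)" "measure srw_space (never_hit v) \<le> 1" for v
    using prob_space.prob_le_1[OF prob_space_srw] by auto
  have "never_hit 0 = {}" by (auto simp: never_hit_def intro!: exI[of _ 0] srw_case_nat)
  then have zero: "measure srw_space (never_hit 0) = 0" by simp
  have pos: "measure srw_space (never_hit (int n)) = 0" for n
  proof (rule bounded_linear_recurrence_zero[of "\<lambda>n. measure srw_space (never_hit (int n))"])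
    show "2 * measure srw_space (never_hit (int (Suc n))) = measure srw_space (never_hit (int (Suc (Suc n)))) + measure srw_space (never_hit (int n))" for n
      using never_hit_average[of "int (Suc n)"] by (simp add: add.commute)
  qed (use zero bounds in auto)
  have neg: "measure srw_space (never_hit (- int n)) = 0" for n
  proof (rule bounded_linear_recurrence_zero[of "\<lambda>n. measure srw_space (never_hit (- int n))"])
    show "2 * measure srw_space (never_hit (- int (Suc n))) = measure srw_space (never_hit (- int (Suc (Suc n)))) + measure srw_space (never_hit (- int n))" for n
      using never_hit_average[of "- int (Suc n)"] by (simp add: algebra_simps)
  qed (use zero bounds in auto)
  show ?thesis using pos neg by (cases v rule: int_cases2) auto
qed

section \<open>Superharmonicity for the discrete Cauchy law\<close>

definition hit_time :: "int \<Rightarrow> (nat \<Rightarrow> int \<times> int) \<Rightarrow> nat" where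
  "hit_time v \<omega> = (LEAST n. v + srw_V n \<omega> = 0)"

text \<open>
  The starting point is \<open>(u, v)\<close>. The deadline \<open>n\<close> for reaching the axis makes expectations accessible
  to induction.
\<close>

definition stopped_reward :: "(int \<Rightarrow> ennreal) \<Rightarrow> nat \<Rightarrow> int \<Rightarrow> int \<Rightarrow> (nat \<Rightarrow> int \<times> int) \<Rightarrow> ennreal" where
  "stopped_reward f n u v \<omega> = (if \<exists>k\<le>n. v + srw_V k \<omega> = 0 then f (u + srw_U (hit_time v \<omega>) \<omega>) else 0)"

lemma hit_position_measurable [measurable]:
  "(\<lambda>\<omega>. srw_U (hit_time v \<omega>) \<omega>) \<in> srw_space \<rightarrow>\<^sub>M count_space UNIV"
proof -
  have "hit_time v \<in> srw_space \<rightarrow>\<^sub>M count_space UNIV"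
    unfolding hit_time_def by measurable
  then show ?thesis by (rule measurable_compose_countable[OF srw_U_measurable])
qed

lemma stopped_reward_measurable [measurable]: "stopped_reward f n u v \<in> borel_measurable srw_space"
proof -
  have f: "(\<lambda>\<omega>. f (u + srw_U (hit_time v \<omega>) \<omega>)) \<in> borel_measurable srw_space"
    by (rule measurable_compose[OF hit_position_measurable]) simp
  have A: "{\<omega> \<in> space srw_space. \<exists>k\<le>n. v + srw_V k \<omega> = 0} \<in> sets srw_space"
    by measurable
  have 0: "(\<lambda>\<omega>. 0) \<in> borel_measurable srw_space" by simp
  show ?thesis
    unfolding stopped_reward_def[abs_def] by (rule measurable_If[OF f 0 A])
qed

lemma hit_time_case_nat:
  assumes "v \<noteq> 0" "\<exists>n. v + snd s + srw_V n \<omega> = 0"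
  shows "hit_time v (case_nat s \<omega>) = Suc (hit_time (v + snd s) \<omega>)"
proof -
  obtain n where "v + snd s + srw_V n \<omega> = 0" using assms(2) by blast
  then have "v + srw_V (Suc n) (case_nat s \<omega>) = 0" by (simp add: srw_case_nat add.assoc)
  moreover have "v + srw_V 0 (case_nat s \<omega>) \<noteq> 0" using assms(1) by (simp add: srw_case_nat)
  ultimately have "hit_time v (case_nat s \<omega>) = Suc (LEAST n. v + srw_V (Suc n) (case_nat s \<omega>) = 0)"
    unfolding hit_time_def by (rule Least_Suc)
  then show ?thesis by (simp add: hit_time_def srw_case_nat add.assoc)
qed

lemma stopped_reward_case_nat:
  assumes "v \<noteq> 0"
  shows "stopped_reward f (Suc n) u v (case_nat s \<omega>) = stopped_reward f n (u + fst s) (v + snd s) \<omega>"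
proof -
  have hit: "(\<exists>k\<le>Suc n. v + srw_V k (case_nat s \<omega>) = 0) \<longleftrightarrow> (\<exists>k\<le>n. v + snd s + srw_V k \<omega> = 0)"
  proof
    assume "\<exists>k\<le>Suc n. v + srw_V k (case_nat s \<omega>) = 0"
    then obtain k where k: "k \<le> Suc n" "v + srw_V k (case_nat s \<omega>) = 0" by blast
    with assms have "k \<noteq> 0" by (auto simp: srw_case_nat intro: gr0I)
    then obtain j where "k = Suc j" by (cases k) auto
    with k show "\<exists>k\<le>n. v + snd s + srw_V k \<omega> = 0" by (auto simp: srw_case_nat add.assoc)
  next
    assume "\<exists>k\<le>n. v + snd s + srw_V k \<omega> = 0"
    then obtain k where "k \<le> n" "v + snd s + srw_V k \<omega> = 0" by blast
    then show "\<exists>k\<le>Suc n. v + srw_V k (case_nat s \<omega>) = 0"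
      by (intro exI[of _ "Suc k"]) (simp add: srw_case_nat add.assoc)
  qed
  have "f (u + srw_U (hit_time v (case_nat s \<omega>)) (case_nat s \<omega>)) = f (u + fst s + srw_U (hit_time (v + snd s) \<omega>) \<omega>)"
    if "\<exists>k\<le>n. v + snd s + srw_V k \<omega> = 0"
  proof -
    have "hit_time v (case_nat s \<omega>) = Suc (hit_time (v + snd s) \<omega>)"
      using that by (intro hit_time_case_nat[OF assms]) blast
    then show ?thesis by (simp only: srw_case_nat add.assoc)
  qed
  then show ?thesis unfolding stopped_reward_def hit by (rule if_cong[OF refl]) (assumption, rule refl)
qed

lemma hit_time_0: "hit_time 0 \<omega> = 0"
  unfolding hit_time_def by (rule Least_equality) (auto simp: srw_case_nat)

text \<open>
  Optional stopping, by induction on the deadline: paths that fail to meet it earn zero, which is at most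
  \<open>a\<close> at their current position.
\<close>

lemma stopped_reward_le:
  fixes a :: "int \<Rightarrow> int \<Rightarrow> real"
  assumes a0: "\<And>u v. 0 \<le> a u v"
    and super: "\<And>u v. v \<noteq> 0 \<Longrightarrow> a (u + 1) v + a (u - 1) v + a u (v + 1) + a u (v - 1) \<le> 4 * a u v"
  shows "(\<integral>\<^sup>+\<omega>. stopped_reward (\<lambda>x. ennreal (a x 0)) n u v \<omega> \<partial>srw_space) \<le> ennreal (a u v)"
proof -
  interpret prob_space srw_space by (rule prob_space_srw)
  let ?k = "stopped_reward (\<lambda>x. ennreal (a x 0))"
  have axis: "(\<integral>\<^sup>+\<omega>. ?k n u 0 \<omega> \<partial>srw_space) \<le> ennreal (a u 0)" for n u
  proof -
    have "(\<integral>\<^sup>+\<omega>. ?k n u 0 \<omega> \<partial>srw_space) \<le> (\<integral>\<^sup>+\<omega>. ennreal (a u 0) \<partial>srw_space)"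
      by (intro nn_integral_mono) (simp add: stopped_reward_def hit_time_0 srw_case_nat)
    then show ?thesis by (simp add: emeasure_space_1)
  qed
  show ?thesis
  proof (induction n arbitrary: u v)
    case 0
    show ?case
    proof (cases "v = 0")
      case True
      show ?thesis unfolding True by (rule axis)
    next
      case False
      then show ?thesis by (simp add: stopped_reward_def srw_case_nat)
    qed
  next
    case (Suc n)
    show ?case
    proof (cases "v = 0")
      case True
      show ?thesis unfolding True by (rule axis)
    next
      case False
      have "4 * (\<integral>\<^sup>+\<omega>. ?k (Suc n) u v \<omega> \<partial>srw_space)
          = (\<Sum>s\<in>steps. \<integral>\<^sup>+\<omega>. ?k n (u + fst s) (v + snd s) \<omega> \<partial>srw_space)"
        by (subst srw_first_step[OF stopped_reward_measurable]) (simp only: stopped_reward_case_nat[OF False])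
      also have "\<dots> \<le> (\<Sum>s\<in>steps. ennreal (a (u + fst s) (v + snd s)))"
        by (intro sum_mono Suc)
      also have "\<dots> = ennreal (a (u + 1) v + a (u - 1) v + a u (v + 1) + a u (v - 1))"
        unfolding four_steps[of a u v, symmetric] by (rule sum_ennreal) (rule a0)
      also have "\<dots> \<le> ennreal (4 * a u v)"
        using super[OF False] by (rule ennreal_leI)
      also have "\<dots> = 4 * ennreal (a u v)"
        using a0 by (simp add: ennreal_mult)
      finally show ?thesis by (rule ennreal_mult_4_le_cancel)
    qed
  qed
qed

text \<open>
  Letting the deadline tend to infinity loses nothing because the axis is reached almost surely; for
  the same reason the arbitrary value of \<open>hit_time\<close> on paths that never reach it is immaterial.
\<close>

lemma hit_expectation_le:
  fixes a :: "int \<Rightarrow> int \<Rightarrow> real"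
  assumes a0: "\<And>u v. 0 \<le> a u v"
    and super: "\<And>u v. v \<noteq> 0 \<Longrightarrow> a (u + 1) v + a (u - 1) v + a u (v + 1) + a u (v - 1) \<le> 4 * a u v"
  shows "(\<integral>\<^sup>+\<omega>. ennreal (a (u + srw_U (hit_time v \<omega>) \<omega>) 0) \<partial>srw_space) \<le> ennreal (a u v)"
proof -
  let ?k = "stopped_reward (\<lambda>x. ennreal (a x 0))"
  have "AE \<omega> in srw_space. \<omega> \<notin> never_hit v"
    using never_hit_null[of v] prob_space_srw
    by (intro AE_not_in) (simp add: null_sets_def finite_measure.emeasure_eq_measure[OF prob_space.axioms(1)])
  with AE_space have "AE \<omega> in srw_space. ennreal (a (u + srw_U (hit_time v \<omega>) \<omega>) 0) = (SUP n. ?k n u v \<omega>)"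
  proof eventually_elim
    case (elim \<omega>)
    then obtain n where n: "v + srw_V n \<omega> = 0" by (auto simp: never_hit_def)
    show ?case
    proof (rule antisym)
      have "ennreal (a (u + srw_U (hit_time v \<omega>) \<omega>) 0) = ?k n u v \<omega>"
        using n by (auto simp: stopped_reward_def)
      also have "\<dots> \<le> (SUP n. ?k n u v \<omega>)" by (rule SUP_upper) simp
      finally show "ennreal (a (u + srw_U (hit_time v \<omega>) \<omega>) 0) \<le> (SUP n. ?k n u v \<omega>)" .
      show "(SUP n. ?k n u v \<omega>) \<le> ennreal (a (u + srw_U (hit_time v \<omega>) \<omega>) 0)"
        by (rule SUP_least) (simp add: stopped_reward_def)
    qed
  qed
  then have "(\<integral>\<^sup>+\<omega>. ennreal (a (u + srw_U (hit_time v \<omega>) \<omega>) 0) \<partial>srw_space) = (\<integral>\<^sup>+\<omega>. (SUP n. ?k n u v \<omega>) \<partial>srw_space)"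
    by (rule nn_integral_cong_AE)
  also have "\<dots> = (SUP n. \<integral>\<^sup>+\<omega>. ?k n u v \<omega> \<partial>srw_space)"
  proof (rule nn_integral_monotone_convergence_SUP)
    show "incseq (\<lambda>n. ?k n u v)"
      by (intro incseq_SucI le_funI) (auto simp: stopped_reward_def intro: le_SucI)
  qed simp
  also have "\<dots> \<le> ennreal (a u v)"
    using stopped_reward_le[OF assms] by (intro SUP_least)
  finally show ?thesis .
qed

text \<open>
  The return time is at least one, so it is one step followed by a hitting time, which may be zero.
\<close>

lemma axis_return_case_nat:
  assumes "\<omega> \<notin> never_hit (snd s)" "\<omega> \<in> space srw_space"
  shows "axis_return_time (case_nat s \<omega>) = Suc (hit_time (snd s) \<omega>)"
proof -
  obtain n where n: "snd s + srw_V n \<omega> = 0" using assms by (auto simp: never_hit_def)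
  have "axis_return_time (case_nat s \<omega>) = Suc (LEAST n. 0 < Suc n \<and> srw_V (Suc n) (case_nat s \<omega>) = 0)"
    unfolding axis_return_time_def
    by (rule Least_Suc[of _ "Suc n"]) (simp_all add: srw_case_nat n)
  then show ?thesis by (simp add: hit_time_def srw_case_nat)
qed

lemma nn_integral_discrete_cauchy:
  "4 * (\<integral>\<^sup>+k. f k \<partial>discrete_cauchy)
     = (\<Sum>s\<in>steps. \<integral>\<^sup>+\<omega>. f (fst s + srw_U (hit_time (snd s) \<omega>) \<omega>) \<partial>srw_space)"
proof -
  have [measurable]: "(\<lambda>\<omega>. f (srw_U (axis_return_time \<omega>) \<omega>)) \<in> borel_measurable srw_space"
    by (rule measurable_compose[OF measurable_axis_return_position]) simp
  have "4 * (\<integral>\<^sup>+k. f k \<partial>discrete_cauchy) = 4 * (\<integral>\<^sup>+\<omega>. f (srw_U (axis_return_time \<omega>) \<omega>) \<partial>srw_space)"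
    unfolding discrete_cauchy_def by (subst nn_integral_distr[OF measurable_axis_return_position]) auto
  also have "\<dots> = (\<Sum>s\<in>steps. \<integral>\<^sup>+\<omega>. f (srw_U (axis_return_time (case_nat s \<omega>)) (case_nat s \<omega>)) \<partial>srw_space)"
    by (rule srw_first_step) measurable
  also have "\<dots> = (\<Sum>s\<in>steps. \<integral>\<^sup>+\<omega>. f (fst s + srw_U (hit_time (snd s) \<omega>) \<omega>) \<partial>srw_space)"
  proof (intro sum.cong refl nn_integral_cong_AE)
    fix s :: "int \<times> int"
    have "AE \<omega> in srw_space. \<omega> \<notin> never_hit (snd s)"
      using never_hit_null[of "snd s"] prob_space_srw
      by (intro AE_not_in) (simp add: null_sets_def finite_measure.emeasure_eq_measure[OF prob_space.axioms(1)])
    with AE_space show "AE \<omega> in srw_space. f (srw_U (axis_return_time (case_nat s \<omega>)) (case_nat s \<omega>))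
         = f (fst s + srw_U (hit_time (snd s) \<omega>) \<omega>)"
      by eventually_elim (simp add: axis_return_case_nat srw_case_nat)
  qed
  finally show ?thesis .
qed

lemma discrete_cauchy_superharmonic:
  fixes a :: "int \<Rightarrow> int \<Rightarrow> real"
  assumes a0: "\<And>u v. 0 \<le> a u v"
    and super: "\<And>u v. v \<noteq> 0 \<Longrightarrow> a (u + 1) v + a (u - 1) v + a u (v + 1) + a u (v - 1) \<le> 4 * a u v"
    and x: "a (x + 1) 0 + a (x - 1) 0 + a x 1 + a x (-1) \<le> 4 * a x 0"
  shows "(\<integral>\<^sup>+k. ennreal (a (x + k) 0) \<partial>discrete_cauchy) \<le> ennreal (a x 0)"
proof -
  have "4 * (\<integral>\<^sup>+k. ennreal (a (x + k) 0) \<partial>discrete_cauchy)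
      = (\<Sum>s\<in>steps. \<integral>\<^sup>+\<omega>. ennreal (a (x + fst s + srw_U (hit_time (snd s) \<omega>) \<omega>) 0) \<partial>srw_space)"
    by (simp only: nn_integral_discrete_cauchy add.assoc)
  also have "\<dots> \<le> (\<Sum>s\<in>steps. ennreal (a (x + fst s) (snd s)))"
    by (intro sum_mono hit_expectation_le a0 super)
  also have "\<dots> = ennreal (a (x + 1) 0 + a (x - 1) 0 + a x 1 + a x (-1))"
    unfolding four_steps[of a x 0, unfolded add_0 diff_0, symmetric] by (rule sum_ennreal) (rule a0)
  also have "\<dots> \<le> ennreal (4 * a x 0)"
    using x by (rule ennreal_leI)
  also have "\<dots> = 4 * ennreal (a x 0)"
    using a0 by (simp add: ennreal_mult)
  finally show ?thesis by (rule ennreal_mult_4_le_cancel)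
qed

lemma discrete_cauchy_neighbour:
  assumes "e = 1 \<or> e = -1"
  shows "1 / 4 \<le> measure discrete_cauchy {e}"
proof -
  interpret prob_space discrete_cauchy by (rule prob_space_discrete_cauchy)
  interpret srw: prob_space srw_space by (rule prob_space_srw)
  have [simp]: "sets discrete_cauchy = UNIV" by (simp add: discrete_cauchy_def)
  have "1 = (\<integral>\<^sup>+\<omega>. indicator {e} (e + srw_U (hit_time 0 \<omega>) \<omega>) \<partial>srw_space)"
    by (simp add: hit_time_0 srw_case_nat srw.emeasure_space_1)
  also have "\<dots> \<le> (\<Sum>s\<in>steps. \<integral>\<^sup>+\<omega>. indicator {e} (fst s + srw_U (hit_time (snd s) \<omega>) \<omega>) \<partial>srw_space)"
  proof -
    have "(e, 0) \<in> steps" using assms by auto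
    then show ?thesis by (subst sum.remove[of _ "(e, 0)"]) simp_all
  qed
  also have "\<dots> = 4 * emeasure discrete_cauchy {e}"
    by (subst nn_integral_discrete_cauchy[symmetric]) simp
  finally have "1 \<le> ennreal (4 * measure discrete_cauchy {e})"
    by (simp add: emeasure_eq_measure ennreal_mult)
  then show ?thesis by simp
qed

section \<open>The Lyapunov function for both laws\<close>

text \<open>
  A step towards the origin multiplies \<open>(1 / 5) ^ nat \<bar>x\<bar>\<close> by 5 and has probability at least 1/4, so
  the expectation of this function grows at least by the factor 5/4.
\<close>

lemma strict_drift:
  fixes f :: "int \<Rightarrow> real"
  assumes R: "prob_space R" "sets R = UNIV"
    and f0: "\<And>x. 0 \<le> f x"
    and super: "(\<integral>\<^sup>+k. ennreal (f (x + k)) \<partial>R) \<le> ennreal (f x)"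
    and unit: "1 / 4 \<le> measure R {1}" "1 / 4 \<le> measure R {-1}"
    and x: "x \<noteq> 0"
  defines "d \<equiv> \<lambda>x. (1 / 5 :: real) ^ nat \<bar>x\<bar>"
  shows "(\<integral>\<^sup>+k. ennreal (f (x + k) + (1 - d (x + k))) \<partial>R) < ennreal (f x + (1 - d x))"
proof -
  interpret prob_space R by (rule R)
  have meas: "h \<in> borel_measurable R" for h :: "int \<Rightarrow> 'b::topological_space"
    using R(2) by (simp add: measurable_def)
  have d: "0 < d y" "d y \<le> 1" for y by (auto simp: d_def power_le_one)
  have int: "integrable R (\<lambda>k. d (x + k))"
    using d less_imp_le[OF d(1)] by (intro integrable_const_bound[where B = 1] meas) auto
  obtain e where e: "e = 1 \<or> e = -1" "nat \<bar>x\<bar> = Suc (nat \<bar>x + e\<bar>)"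
    by (cases "0 < x") (rule that[of "-1"]; use x in simp; fail | rule that[of 1]; use x in simp)+
  have quarter: "d x < d (x + e) * (1 / 4)"
    unfolding d_def e(2) by simp
  have "d x < 1" using quarter d(2)[of "x + e"] by simp
  have "d x < d (x + e) * (1 / 4)" by (rule quarter)
  also have "\<dots> \<le> d (x + e) * measure R {e}"
    using e(1) unit less_imp_le[OF d(1)] by (intro mult_left_mono) auto
  also have "\<dots> = (\<integral>k. d (x + e) * indicator {e} k \<partial>R)"
    using R(2) by simp
  also have "\<dots> \<le> (\<integral>k. d (x + k) \<partial>R)"
  proof (rule integral_mono)
    show "integrable R (\<lambda>k. d (x + e) * indicator {e} k)"
      using R(2) by (intro integrable_mult_right integrable_real_indicator) (auto simp: emeasure_eq_measure)
    show "d (x + e) * indicator {e} k \<le> d (x + k)" for k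
      using less_imp_le[OF d(1)] by (auto simp: indicator_def)
  qed (rule int)
  finally have gain: "d x < (\<integral>k. d (x + k) \<partial>R)" .
  have "(\<integral>\<^sup>+k. ennreal (f (x + k) + (1 - d (x + k))) \<partial>R)
      = (\<integral>\<^sup>+k. ennreal (f (x + k)) + ennreal (1 - d (x + k)) \<partial>R)"
    using f0 d by (intro nn_integral_cong ennreal_plus) auto
  also have "\<dots> = (\<integral>\<^sup>+k. ennreal (f (x + k)) \<partial>R) + (\<integral>\<^sup>+k. ennreal (1 - d (x + k)) \<partial>R)"
    by (intro nn_integral_add meas)
  also have "(\<integral>\<^sup>+k. ennreal (1 - d (x + k)) \<partial>R) = ennreal (\<integral>k. 1 - d (x + k) \<partial>R)"
    using int d by (intro nn_integral_eq_integral) auto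
  also have "(\<integral>k. 1 - d (x + k) \<partial>R) = 1 - (\<integral>k. d (x + k) \<partial>R)"
    using int by (simp add: prob_space)
  also have "(\<integral>\<^sup>+k. ennreal (f (x + k)) \<partial>R) + ennreal (1 - (\<integral>k. d (x + k) \<partial>R))
      \<le> ennreal (f x) + ennreal (1 - (\<integral>k. d (x + k) \<partial>R))"
    using super by (rule add_right_mono)
  also have "\<dots> < ennreal (f x) + ennreal (1 - d x)"
    using gain \<open>d x < 1\<close> by (simp add: ennreal_add_left_cancel_less ennreal_lessI)
  also have "\<dots> = ennreal (f x + (1 - d x))"
    using f0 d by (intro ennreal_plus[symmetric]) auto
  finally show ?thesis .
qed

definition lyapunov :: "int \<Rightarrow> real" where
  "lyapunov x = potential x 0 + (1 - (1 / 5) ^ nat \<bar>x\<bar>)"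

lemma P1_superharmonic:
  assumes "x \<noteq> 0"
  shows "(\<integral>\<^sup>+k. ennreal (potential (x + k) 0) \<partial>P1) \<le> ennreal (potential x 0)"
proof -
  have "(\<integral>\<^sup>+k. ennreal (potential (x + k) 0) \<partial>P1) = (ennreal (potential (x + 1) 0) + ennreal (potential (x - 1) 0)) / 2"
    unfolding P1_def by (subst nn_integral_pmf_of_set) simp_all
  also have "\<dots> = ennreal ((potential (x + 1) 0 + potential (x - 1) 0) / 2)"
    using potential_nonneg by (simp only: ennreal_plus[symmetric] divide_ennreal[symmetric] add_nonneg_nonneg zero_less_numeral ennreal_numeral)
  also have "\<dots> \<le> ennreal (potential x 0)"
    using potential_concave[OF assms] by (intro ennreal_leI) simp
  finally show ?thesis .
qed

lemma P2_superharmonic: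
  assumes "x \<noteq> 0"
  shows "(\<integral>\<^sup>+k. ennreal (potential (x + k) 0) \<partial>P2) \<le> ennreal (potential x 0)"
proof -
  define a where "a = (\<lambda>u v. potential u (nat \<bar>v\<bar>))"
  have "(\<integral>\<^sup>+k. ennreal (a (x + k) 0) \<partial>discrete_cauchy) \<le> ennreal (a x 0)"
  proof (rule discrete_cauchy_superharmonic)
    fix u v :: int
    show "0 \<le> a u v" by (simp add: a_def potential_nonneg)
    assume "v \<noteq> 0"
    then obtain y where y: "v = int (Suc y) \<or> v = - int (Suc y)"
      by (cases v rule: int_cases3) (auto dest: gr0_implies_Suc)
    have "nat \<bar>int (Suc y) + 1\<bar> = Suc (Suc y)" "nat \<bar>int (Suc y) - 1\<bar> = y"
         "nat \<bar>- int (Suc y) + 1\<bar> = y" "nat \<bar>- int (Suc y) - 1\<bar> = Suc (Suc y)"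
         "nat \<bar>int (Suc y)\<bar> = Suc y" "nat \<bar>- int (Suc y)\<bar> = Suc y" by simp_all
    with y potential_harmonic_off_axis[of u y]
    show "a (u + 1) v + a (u - 1) v + a u (v + 1) + a u (v - 1) \<le> 4 * a u v"
      unfolding a_def by (elim disjE) simp_all
  next
    show "a (x + 1) 0 + a (x - 1) 0 + a x 1 + a x (-1) \<le> 4 * a x 0"
      using potential_harmonic_on_axis[OF assms] by (simp add: a_def)
  qed
  then show ?thesis by (simp add: a_def P2_def)
qed

theorem mainTheorem3:
  shows "(\<forall>(M :: 'a measure) S i.
            indexed_process M S i \<and> satisfies_CL P1 P2 M S i \<longrightarrow> recurrent M S) \<and>
         (\<forall>(M :: 'a measure) S i. benjamini_process M S i \<longrightarrow> recurrent M S)"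
proof -
  have P: "prob_space P1" "prob_space P2" "sets P1 = UNIV" "sets P2 = UNIV"
    using prob_space_discrete_cauchy
    by (auto simp: P1_def P2_def discrete_cauchy_def intro: prob_space_measure_pmf)
  have unit: "1 / 4 \<le> measure R {1}" "1 / 4 \<le> measure R {-1}" if "R = P1 \<or> R = P2" for R
    using that discrete_cauchy_neighbour[of 1] discrete_cauchy_neighbour[of "-1"]
    by (auto simp: P1_def P2_def measure_pmf_of_set)
  have drift: "(\<integral>\<^sup>+k. ennreal (lyapunov (x + k)) \<partial>R) < ennreal (lyapunov x)" if "x \<noteq> 0" "R = P1 \<or> R = P2" for x R
    unfolding lyapunov_def
    using that P unit[OF that(2)] P1_superharmonic[OF that(1)] P2_superharmonic[OF that(1)]
    by (intro strict_drift potential_nonneg) auto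
  have recur: "recurrent M S" if ip: "indexed_process M S i" and CL: "satisfies_CL P1 P2 M S i" for M :: "'a measure" and S i
    unfolding recurrent_def
  proof
    fix u
    show "AE \<omega> in M. infinite {n. S n \<omega> = u}"
    proof (rule Lyapunov_recurrence[OF ip CL P])
      show "0 \<le> lyapunov (x - u)" for x
        using potential_nonneg[of "x - u" 0] by (simp add: lyapunov_def power_le_one add_nonneg_nonneg)
      have "{x. lyapunov (x - u) < L} \<subseteq> (\<lambda>y. y + u) ` {y. potential y 0 < L}" for L
      proof
        fix x assume "x \<in> {x. lyapunov (x - u) < L}"
        moreover have "(1 / 5 :: real) ^ nat \<bar>x - u\<bar> \<le> 1" by (simp add: power_le_one)
        ultimately have "x - u \<in> {y. potential y 0 < L}" by (simp add: lyapunov_def)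
        then show "x \<in> (\<lambda>y. y + u) ` {y. potential y 0 < L}" by force
      qed
      then show "finite {x. lyapunov (x - u) < L}" for L
        using finite_potential_sublevel[of L] by (meson finite_imageI finite_subset)
      show "(\<integral>\<^sup>+k. ennreal (lyapunov (x + k - u)) \<partial>R) < ennreal (lyapunov (x - u))"
        if "x \<noteq> u" "R = P1 \<or> R = P2" for x R
        using drift[of "x - u" R] that by (simp add: algebra_simps)
    qed
  qed
  then show ?thesis unfolding benjamini_process_def by blast
qed

end
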